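(* Let $A$ be a graded superring, $B$ a graded subring, $\alpha$ an automorphism of $A$, $\beta$ an automorphism of $B$, $\lambda\in\Lambda$, $\pi\in\mathbb{Z}_2$. Then $A$ is an $(\alpha,\beta)$-Frobenius extension of $B$ of degree $(-\lambda,\pi)$ if and only if there exist a homomorphism of $(B,B)$-bimodules $\mathrm{tr}\colon{}^{\beta}_{B}A^{\alpha}_{B}\to\{\lambda,\pi\}{}_BB_B$ and finite subsets $\{x_1,\dots,x_n\}$, $\{y_1,\dots,y_n\}$ of (homogeneous elements of) $A$ such that $(|y_i|,\bar y_i)=(\lambda-|x_i|,\pi+\bar x_i)$ for $i=1,\dots,n$, and $$a=(-1)^{\pi\bar a}\sum_{i=1}^n(-1)^{\pi\bar x_i}\beta\big(\mathrm{tr}(ay_i)\big)x_i=\sum_{i=1}^n\alpha^{-1}(y_i)\,\mathrm{tr}\big(x_i\alpha(a)\big)\quad\text{for all }a\in A,$$ where in these formulas $\mathrm{tr}$ is viewed as a map $A\to B$ of degree $(-\lambda,\pi)$.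
   Context: Fix an abelian group $\Lambda$. A graded superring is an associative unital $\Lambda\times\mathbb{Z}_2$-graded ring; subrings are graded (with the same unit), automorphisms preserve the grading, and modules and bimodules are $\Lambda\times\mathbb{Z}_2$-graded. For homogeneous $v$, $|v|\in\Lambda$ and $\bar v\in\mathbb{Z}_2$ denote its degrees; formulas involving degrees are stated for homogeneous elements and extended additively. Homomorphisms of modules and bimodules are additive maps of degree $(0,0)$ commuting strictly with the actions. Shifts: $\{\mu,\gamma\}M$ is $M$ as an abelian group, with $(\{\mu,\gamma\}M)_{\nu,\delta}=M_{\nu-\mu,\delta+\gamma}$, unchanged right action, and left action $a\cdot\{\mu,\gamma\}m=(-1)^{\gamma\bar a}\{\mu,\gamma\}(am)$. Twists: ${}^{\beta}_{B}A^{\alpha}_{A}$ is $A$ as a graded abelian group with $b\cdot x=\beta(b)x$ ($b\in B$) and $x\cdot a=x\alpha(a)$ ($a\in A$); ${}^{\beta}_{B}A^{\alpha}_{B}$ is the same with the right action restricted to $B$. Thus a homomorphism of $(B,B)$-bimodules $\mathrm{tr}\colon{}^{\beta}_{B}A^{\alpha}_{B}\to\{\lambda,\pi\}{}_BB_B$ is the same as an additive map $\mathrm{tr}\colon A\to B$ of degree $(-\lambda,\pi)$ with $\mathrm{tr}(\beta(b)x)=(-1)^{\pi\bar b}b\,\mathrm{tr}(x)$ and $\mathrm{tr}(x\alpha(b))=\mathrm{tr}(x)b$ for $b\in B$, $x\in A$. $\mathrm{HOM}^{\mathrm L}_B({}^{\beta}_{B}A^{\alpha}_{A},\{\lambda,\pi\}{}_BB_B)$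 is the direct sum over $(\mu,\gamma)\in\Lambda\times\mathbb{Z}_2$ of the groups of additive maps $f\colon A\to\{\lambda,\pi\}B$ of degree $(\mu,\gamma)$ with $f(\beta(b)x)=(-1)^{\gamma\bar b}\,b\cdot f(x)$ (action in $\{\lambda,\pi\}B$). It is an $(A,B)$-bimodule via $(a\cdot f)(x)=(-1)^{\bar a\bar f+\bar a\bar x}f(x\alpha(a))$ and $(f\cdot b)(x)=(-1)^{\bar b\bar x}f(x)b$. $A$ is an $(\alpha,\beta)$-Frobenius extension of $B$ of degree $(-\lambda,\pi)$ if (L1) $A$ is finitely generated and projective as a left $B$-module, and (L2) ${}_AA_B\cong\mathrm{HOM}^{\mathrm L}_B({}^{\beta}_{B}A^{\alpha}_{A},\{\lambda,\pi\}{}_BB_B)$ as $(A,B)$-bimodules. *)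

theory Defs
  imports "HOL-Library.Z2" "HOL-Library.Product_Plus" "HOL-Library.Function_Algebras"
begin

section \<open>Graded groups\<close>

text \<open>
  A grading is a family of subsets \<open>G d\<close> of an ambient additive group; the graded object is the
  internal direct sum \<open>carr G\<close> of the \<open>G d\<close>.  Degrees are elements of \<open>'l \<times> bit\<close>, where \<open>'l\<close> is
  the abelian group $\Lambda$ and \<open>bit\<close> is the integers mod 2.
\<close>

definition carr :: "('d \<Rightarrow> 'm::ab_group_add set) \<Rightarrow> 'm set" where
  "carr G = {\<Sum>d\<in>I. x d | I x. finite I \<and> (\<forall>d\<in>I. x d \<in> G d)}"

definition graded_group :: "('d \<Rightarrow> 'm::ab_group_add set) \<Rightarrow> bool" where
  "graded_group G \<longleftrightarrow>
     (\<forall>d. 0 \<in> G d \<and> (\<forall>x\<in>G d. \<forall>y\<in>G d. x - y \<in> G d)) \<and>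
     (\<forall>I x. finite I \<longrightarrow> (\<forall>d\<in>I. x d \<in> G d) \<longrightarrow> (\<Sum>d\<in>I. x d) = 0 \<longrightarrow> (\<forall>d\<in>I. x d = 0))"

text \<open>\<open>psign p x\<close> is $(-1)^p x$.\<close>

definition psign :: "bit \<Rightarrow> 'm::ab_group_add \<Rightarrow> 'm" where
  "psign p x = (if p = 0 then x else - x)"

text \<open>
  The component of parity \<open>p\<close> of an element of a graded group.  A formula whose signs depend on
  the parities of its arguments is extended additively from homogeneous elements by summing over
  the parity components of the arguments.
\<close>

definition par :: "('l \<times> bit \<Rightarrow> 'm::ab_group_add set) \<Rightarrow> bit \<Rightarrow> 'm \<Rightarrow> 'm" where
  "par G p x = (THE y. y \<in> carr (\<lambda>l. G (l, p)) \<and> x - y \<in> carr (\<lambda>l. G (l, p + 1)))"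

section \<open>Graded superrings\<close>

text \<open>
  The ambient ring is of sort \<open>{ring, monoid_mult}\<close> rather than \<open>ring_1\<close>, because the latter
  excludes the zero ring.
\<close>

definition graded_superring ::
    "('l::ab_group_add \<times> bit \<Rightarrow> 'r::{ring, monoid_mult} set) \<Rightarrow> bool" where
  "graded_superring R \<longleftrightarrow>
     graded_group R \<and> 1 \<in> R 0 \<and> (\<forall>d e. \<forall>r\<in>R d. \<forall>s\<in>R e. r * s \<in> R (d + e))"

definition restrict_grading :: "('d \<Rightarrow> 'r set) \<Rightarrow> 'r set \<Rightarrow> 'd \<Rightarrow> 'r set" where
  "restrict_grading R B = (\<lambda>d. R d \<inter> B)"

definition graded_subring :: "('d \<Rightarrow> 'r::{ring, monoid_mult} set) \<Rightarrow> 'r set \<Rightarrow> bool" where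
  "graded_subring R B \<longleftrightarrow>
     B \<subseteq> carr R \<and> 1 \<in> B \<and> (\<forall>x\<in>B. \<forall>y\<in>B. x - y \<in> B \<and> x * y \<in> B) \<and>
     carr (restrict_grading R B) = B"

definition graded_automorphism ::
    "('d \<Rightarrow> 'r::{ring, monoid_mult} set) \<Rightarrow> ('r \<Rightarrow> 'r) \<Rightarrow> bool" where
  "graded_automorphism R f \<longleftrightarrow>
     bij_betw f (carr R) (carr R) \<and> f 1 = 1 \<and>
     (\<forall>x\<in>carr R. \<forall>y\<in>carr R. f (x + y) = f x + f y \<and> f (x * y) = f x * f y) \<and>
     (\<forall>d. f ` R d \<subseteq> R d)"

section \<open>Graded modules and bimodules\<close>

record ('l, 'r, 'm) gmod =
  gr :: "'l \<times> bit \<Rightarrow> 'm set"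
  lact :: "'r \<Rightarrow> 'm \<Rightarrow> 'm"

record ('l, 'r, 'm, 's) gbimod = "('l, 'r, 'm) gmod" +
  ract :: "'m \<Rightarrow> 's \<Rightarrow> 'm"

definition graded_left_module ::
    "('l::ab_group_add \<times> bit \<Rightarrow> 'r::{ring, monoid_mult} set) \<Rightarrow>
     ('l, 'r, 'm::ab_group_add, 'z) gmod_scheme \<Rightarrow> bool" where
  "graded_left_module R M \<longleftrightarrow>
     graded_group (gr M) \<and>
     (\<forall>d e. \<forall>r\<in>R d. \<forall>x\<in>gr M e. lact M r x \<in> gr M (d + e)) \<and>
     (\<forall>r\<in>carr R. \<forall>x\<in>carr (gr M). \<forall>y\<in>carr (gr M).
        lact M r (x + y) = lact M r x + lact M r y) \<and>
     (\<forall>r\<in>carr R. \<forall>s\<in>carr R. \<forall>x\<in>carr (gr M).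
        lact M (r + s) x = lact M r x + lact M s x \<and>
        lact M (r * s) x = lact M r (lact M s x)) \<and>
     (\<forall>x\<in>carr (gr M). lact M 1 x = x)"

definition left_hom ::
    "('l \<times> bit \<Rightarrow> 'r::ring set) \<Rightarrow> ('l, 'r, 'm::ab_group_add, 'y) gmod_scheme \<Rightarrow>
     ('l, 'r, 'n::ab_group_add, 'z) gmod_scheme \<Rightarrow> ('m \<Rightarrow> 'n) \<Rightarrow> bool" where
  "left_hom R M N f \<longleftrightarrow>
     (\<forall>x\<in>carr (gr M). \<forall>y\<in>carr (gr M). f (x + y) = f x + f y) \<and>
     (\<forall>d. f ` gr M d \<subseteq> gr N d) \<and>
     (\<forall>r\<in>carr R. \<forall>x\<in>carr (gr M). f (lact M r x) = lact N r (f x))"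

definition bimod_hom ::
    "('l \<times> bit \<Rightarrow> 'r::ring set) \<Rightarrow> ('l \<times> bit \<Rightarrow> 's::ring set) \<Rightarrow>
     ('l, 'r, 'm::ab_group_add, 's) gbimod \<Rightarrow> ('l, 'r, 'n::ab_group_add, 's) gbimod \<Rightarrow>
     ('m \<Rightarrow> 'n) \<Rightarrow> bool" where
  "bimod_hom R S M N f \<longleftrightarrow>
     left_hom R M N f \<and> (\<forall>x\<in>carr (gr M). \<forall>s\<in>carr S. f (ract M x s) = ract N (f x) s)"

definition bimod_isomorphic ::
    "('l \<times> bit \<Rightarrow> 'r::ring set) \<Rightarrow> ('l \<times> bit \<Rightarrow> 's::ring set) \<Rightarrow>
     ('l, 'r, 'm::ab_group_add, 's) gbimod \<Rightarrow> ('l, 'r, 'n::ab_group_add, 's) gbimod \<Rightarrow> bool" where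
  "bimod_isomorphic R S M N \<longleftrightarrow>
     (\<exists>f. bimod_hom R S M N f \<and> bij_betw f (carr (gr M)) (carr (gr N)))"

text \<open>The shift $\{\mu,\gamma\}M$ of an $(R,S)$-bimodule.\<close>

definition shift ::
    "('l::ab_group_add \<times> bit \<Rightarrow> 'r::ring set) \<Rightarrow> 'l \<Rightarrow> bit \<Rightarrow>
     ('l, 'r, 'm::ab_group_add, 's) gbimod \<Rightarrow> ('l, 'r, 'm, 's) gbimod" where
  "shift R \<mu> \<gamma> M =
     \<lparr>gr = (\<lambda>(\<nu>, \<delta>). gr M (\<nu> - \<mu>, \<delta> + \<gamma>)),
      lact = (\<lambda>a x. \<Sum>p\<in>{0, 1}. psign (\<gamma> * p) (lact M (par R p a) x)),
      ract = ract M\<rparr>"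

text \<open>
  The graded group \<open>GA\<close> with the actions $b \cdot x = \beta(b) x$ and $x \cdot a = x \alpha(a)$.
  The rings acting are not part of the bimodule: they are the gradings passed to
  \<^const>\<open>bimod_hom\<close>, \<^const>\<open>bimod_isomorphic\<close> and \<open>HOM_L\<close>, so restriction of an action to a
  subring needs no separate construction.
\<close>

definition twisted ::
    "('l \<times> bit \<Rightarrow> 'a::ring set) \<Rightarrow> ('a \<Rightarrow> 'a) \<Rightarrow> ('a \<Rightarrow> 'a) \<Rightarrow> ('l, 'a, 'a, 'a) gbimod" where
  "twisted GA \<beta> \<alpha> = \<lparr>gr = GA, lact = (\<lambda>b x. \<beta> b * x), ract = (\<lambda>x a. x * \<alpha> a)\<rparr>"

definition regular :: "('l \<times> bit \<Rightarrow> 'a::ring set) \<Rightarrow> ('l, 'a, 'a, 'a) gbimod" where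
  "regular G = \<lparr>gr = G, lact = (*), ract = (*)\<rparr>"

section \<open>The bimodule of homomorphisms of left modules\<close>

text \<open>
  \<open>HOM_deg R M N (\<mu>, \<gamma>)\<close> consists of the additive maps of degree $(\mu,\gamma)$ from \<open>M\<close> to \<open>N\<close> with
  $f(rx) = (-1)^{\gamma\bar r} r f(x)$.  They are extended by 0 outside of \<open>M\<close>, so that equality of
  maps is equality of functions.
\<close>

definition HOM_deg ::
    "('l::ab_group_add \<times> bit \<Rightarrow> 'r::ring set) \<Rightarrow> ('l, 'r, 'm::ab_group_add, 's) gbimod \<Rightarrow>
     ('l, 'r, 'n::ab_group_add, 't) gbimod \<Rightarrow> 'l \<times> bit \<Rightarrow> ('m \<Rightarrow> 'n) set" where
  "HOM_deg R M N d = {f.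
     (\<forall>x\<in>carr (gr M). \<forall>y\<in>carr (gr M). f (x + y) = f x + f y) \<and>
     (\<forall>x. x \<notin> carr (gr M) \<longrightarrow> f x = 0) \<and>
     (\<forall>e. \<forall>x\<in>gr M e. f x \<in> gr N (e + d)) \<and>
     (\<forall>e. \<forall>r\<in>R e. \<forall>x\<in>carr (gr M). f (lact M r x) = psign (snd d * snd e) (lact N r (f x)))}"

text \<open>
  For an $(R,S)$-bimodule \<open>M\<close> and an $(R,T)$-bimodule \<open>N\<close>, the $(S,T)$-bimodule of left
  \<open>R\<close>-homomorphisms, with the actions
  $(s \cdot f)(x) = (-1)^{\bar s\bar f + \bar s\bar x} f(x s)$ and
  $(f \cdot t)(x) = (-1)^{\bar t\bar x} f(x) t$.
\<close>

definition HOM_L ::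
    "('l::ab_group_add \<times> bit \<Rightarrow> 'r::ring set) \<Rightarrow> ('l \<times> bit \<Rightarrow> 's::ring set) \<Rightarrow>
     ('l \<times> bit \<Rightarrow> 't::ring set) \<Rightarrow> ('l, 'r, 'm::ab_group_add, 's) gbimod \<Rightarrow>
     ('l, 'r, 'n::ab_group_add, 't) gbimod \<Rightarrow> ('l, 's, 'm \<Rightarrow> 'n, 't) gbimod" where
  "HOM_L R S T M N =
     \<lparr>gr = HOM_deg R M N,
      lact = (\<lambda>s f x. if x \<in> carr (gr M) then
        (\<Sum>p\<in>{0, 1}. \<Sum>q\<in>{0, 1}. \<Sum>k\<in>{0, 1}.
           psign (p * q + p * k) (par (HOM_deg R M N) q f (ract M (par (gr M) k x) (par S p s))))
        else 0),
      ract = (\<lambda>f t x. if x \<in> carr (gr M) then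
        (\<Sum>p\<in>{0, 1}. \<Sum>k\<in>{0, 1}.
           psign (p * k) (ract N (f (par (gr M) k x)) (par T p t)))
        else 0)\<rparr>"

section \<open>Finitely generated and projective modules\<close>

definition finitely_generated ::
    "('l \<times> bit \<Rightarrow> 'r::ring set) \<Rightarrow> ('l, 'r, 'm::ab_group_add, 'z) gmod_scheme \<Rightarrow> bool" where
  "finitely_generated R M \<longleftrightarrow>
     (\<exists>S. finite S \<and> S \<subseteq> carr (gr M) \<and>
        (\<forall>x\<in>carr (gr M). \<exists>c. (\<forall>s\<in>S. c s \<in> carr R) \<and> x = (\<Sum>s\<in>S. lact M (c s) s)))"

definition lifts_through ::
    "('l::ab_group_add \<times> bit \<Rightarrow> 'r::{ring, monoid_mult} set) \<Rightarrow>
     ('l, 'r, 'm::ab_group_add, 'z) gmod_scheme \<Rightarrow>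
     ('l, 'r, 'n::ab_group_add) gmod \<Rightarrow> ('l, 'r, 'k::ab_group_add) gmod \<Rightarrow> bool" where
  "lifts_through R P M N \<longleftrightarrow>
     (graded_left_module R M \<longrightarrow> graded_left_module R N \<longrightarrow>
      (\<forall>g f. left_hom R M N g \<and> g ` carr (gr M) = carr (gr N) \<and> left_hom R P N f \<longrightarrow>
         (\<exists>h. left_hom R P M h \<and> (\<forall>x\<in>carr (gr P). g (h x) = f x))))"

text \<open>
  Projectivity is the lifting property against surjections \<open>M \<rightarrow> N\<close> of graded modules.  A
  definition cannot quantify over the types carrying \<open>M\<close> and \<open>N\<close>; those chosen here accommodate
  the free cover of \<open>P\<close> on its homogeneous elements and \<open>P\<close> itself, so the lifting property
  follows for modules over arbitrary types (lemma \<open>projective_lifts_through\<close> below).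
\<close>

definition projective ::
    "('l::ab_group_add \<times> bit \<Rightarrow> 'r::{ring, monoid_mult} set) \<Rightarrow>
     ('l, 'r, 'm::ab_group_add, 'z) gmod_scheme \<Rightarrow> bool" where
  "projective R P \<longleftrightarrow>
     (\<forall>(M :: ('l, 'r, 'm \<Rightarrow> 'r) gmod) (N :: ('l, 'r, 'm) gmod). lifts_through R P M N)"

subsection \<open>The lifting property for modules over arbitrary types\<close>

lemma carrI: "finite I \<Longrightarrow> (\<And>d. d \<in> I \<Longrightarrow> x d \<in> G d) \<Longrightarrow> (\<Sum>d\<in>I. x d) \<in> carr G"
  unfolding carr_def by blast

lemma carrE:
  assumes "x \<in> carr G"
  obtains I c where "finite I" "\<And>d. d \<in> I \<Longrightarrow> c d \<in> G d" "x = (\<Sum>d\<in>I. c d)"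
  using assms unfolding carr_def by blast

lemma in_carr: "x \<in> G d \<Longrightarrow> x \<in> carr G"
  using carrI[of "{d}" "\<lambda>_. x" G] by simp

lemma graded_group_zero: "graded_group G \<Longrightarrow> 0 \<in> G d"
  unfolding graded_group_def by blast

lemma graded_group_diff: "graded_group G \<Longrightarrow> x \<in> G d \<Longrightarrow> y \<in> G d \<Longrightarrow> x - y \<in> G d"
  unfolding graded_group_def by blast

lemma graded_group_add: "graded_group G \<Longrightarrow> x \<in> G d \<Longrightarrow> y \<in> G d \<Longrightarrow> x + y \<in> G d"
  using graded_group_diff[of G x d "0 - y"] graded_group_diff[of G 0 d y] graded_group_zero[of G d]
  by simp

lemma graded_group_sum:
  "graded_group G \<Longrightarrow> (\<And>i. i \<in> I \<Longrightarrow> x i \<in> G d) \<Longrightarrow> (\<Sum>i\<in>I. x i) \<in> G d"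
  by (induction I rule: infinite_finite_induct)
    (auto simp: graded_group_zero intro: graded_group_add)

lemma graded_group_indep:
  "graded_group G \<Longrightarrow> finite I \<Longrightarrow> (\<And>d. d \<in> I \<Longrightarrow> x d \<in> G d) \<Longrightarrow> (\<Sum>d\<in>I. x d) = 0 \<Longrightarrow>
    d \<in> I \<Longrightarrow> x d = 0"
  unfolding graded_group_def by blast

lemma carr_zero: "0 \<in> carr G"
  using carrI[of "{}" "\<lambda>_. 0" G] by simp

lemma carr_add:
  assumes G: "graded_group G" and x: "x \<in> carr G" and y: "y \<in> carr G"
  shows "x + y \<in> carr G"
proof -
  obtain I c where I: "finite I" "\<And>d. d \<in> I \<Longrightarrow> c d \<in> G d" "x = (\<Sum>d\<in>I. c d)"
    by (rule carrE[OF x]) blast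
  obtain J b where J: "finite J" "\<And>d. d \<in> J \<Longrightarrow> b d \<in> G d" "y = (\<Sum>d\<in>J. b d)"
    by (rule carrE[OF y]) blast
  have "x = (\<Sum>d\<in>I \<union> J. if d \<in> I then c d else 0)"
    using I J(1) by (subst sum.mono_neutral_right[of "I \<union> J" I]) auto
  moreover have "y = (\<Sum>d\<in>I \<union> J. if d \<in> J then b d else 0)"
    using J I(1) by (subst sum.mono_neutral_right[of "I \<union> J" J]) auto
  ultimately have "x + y = (\<Sum>d\<in>I \<union> J. (if d \<in> I then c d else 0) + (if d \<in> J then b d else 0))"
    by (simp add: sum.distrib)
  also have "\<dots> \<in> carr G"
    using I J G by (intro carrI) (auto intro: graded_group_add graded_group_zero)
  finally show ?thesis .
qed

lemma carr_sum:
  "graded_group G \<Longrightarrow> (\<And>i. i \<in> I \<Longrightarrow> x i \<in> carr G) \<Longrightarrow> (\<Sum>i\<in>I. x i) \<in> carr G"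
  by (induction I rule: infinite_finite_induct) (auto simp: carr_zero intro: carr_add)

lemma carr_induct [consumes 2, case_names hom add]:
  assumes G: "graded_group G" and x: "x \<in> carr G"
    and hom: "\<And>d x. x \<in> G d \<Longrightarrow> P x"
    and add: "\<And>x y. x \<in> carr G \<Longrightarrow> y \<in> carr G \<Longrightarrow> P x \<Longrightarrow> P y \<Longrightarrow> P (x + y)"
  shows "P x"
proof -
  obtain I c where I: "finite I" "\<And>d. d \<in> I \<Longrightarrow> c d \<in> G d" "x = (\<Sum>d\<in>I. c d)"
    by (rule carrE[OF x]) blast
  have "P (\<Sum>d\<in>I. c d)"
    using I(1,2)
  proof (induction I)
    case empty
    show ?case using hom[OF graded_group_zero[OF G]] by simp
  next
    case (insert a I)
    have "c a \<in> carr G" "(\<Sum>d\<in>I. c d) \<in> carr G"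
      using insert by (auto intro: in_carr carrI)
    moreover have "P (c a)" using insert.prems hom by blast
    moreover have "P (\<Sum>d\<in>I. c d)" using insert by blast
    ultimately show ?case using insert.hyps add by simp
  qed
  then show ?thesis using I by simp
qed

lemma graded_degree_unique:
  assumes "graded_group G" "x \<in> G d" "x \<in> G e" "x \<noteq> 0"
  shows "d = e"
proof (rule ccontr)
  assume ne: "d \<noteq> e"
  have "(\<Sum>i\<in>{d, e}. if i = d then x else - x) = 0"
    using ne by simp
  moreover have "- x \<in> G e"
    using graded_group_diff[OF assms(1) graded_group_zero[OF assms(1)] assms(3)] by simp
  moreover have "(if i = d then x else - x) \<in> G i" if "i \<in> {d, e}" for i
    using that assms(2) calculation(2) by (cases "i = d") auto
  ultimately have "(if d = d then x else - x) = 0"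
    using graded_group_indep[OF assms(1), of "{d, e}" "\<lambda>i. if i = d then x else - x" d]
    by blast
  then show False using assms(4) by simp
qed

lemma left_hom_zero: "left_hom R M N f \<Longrightarrow> f 0 = 0"
  unfolding left_hom_def using carr_zero[of "gr M"] by (metis add_cancel_right_left)

lemma left_hom_sum:
  assumes "left_hom R M N f" "graded_group (gr M)" "\<And>i. i \<in> I \<Longrightarrow> x i \<in> carr (gr M)"
  shows "f (\<Sum>i\<in>I. x i) = (\<Sum>i\<in>I. f (x i))"
  using assms(3)
proof (induction I rule: infinite_finite_induct)
  case (insert a I)
  then have "(\<Sum>i\<in>I. x i) \<in> carr (gr M)" by (auto intro: carr_sum[OF assms(2)])
  then show ?case using insert assms(1) unfolding left_hom_def by simp
qed (use left_hom_zero[OF assms(1)] in auto)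

lemma left_hom_carr:
  assumes f: "left_hom R M N f" and M: "graded_group (gr M)" and N: "graded_group (gr N)"
    and x: "x \<in> carr (gr M)"
  shows "f x \<in> carr (gr N)"
  using M x
proof (induction rule: carr_induct)
  case (hom d x)
  then have "f x \<in> gr N d" using f unfolding left_hom_def by blast
  then show ?case by (rule in_carr)
next
  case (add x y)
  then show ?case using f carr_add[OF N] unfolding left_hom_def by simp
qed

lemma homogeneous_preimage:
  assumes M: "graded_group (gr M)" and N: "graded_group (gr N)"
    and g: "left_hom R M N g" "g ` carr (gr M) = carr (gr N)" and n: "n \<in> gr N d"
  shows "\<exists>m\<in>gr M d. g m = n"
proof -
  obtain m where m: "m \<in> carr (gr M)" "g m = n"
    using g(2) in_carr[of n "gr N" d] n by force
  obtain I c where I: "finite I" "\<And>e. e \<in> I \<Longrightarrow> c e \<in> gr M e" "m = (\<Sum>e\<in>I. c e)"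
    by (rule carrE[OF m(1)]) blast
  define b where "b = (\<lambda>e. if e \<in> I then c e else 0)"
  have b: "b e \<in> gr M e" for e
    using I graded_group_zero[OF M] by (auto simp: b_def)
  have mb: "m = (\<Sum>e\<in>insert d I. b e)"
    unfolding b_def using I by (subst sum.mono_neutral_right[of "insert d I" I]) auto
  have "n = (\<Sum>e\<in>insert d I. g (b e))"
    using left_hom_sum[OF g(1) M, of "insert d I" b] b in_carr m(2) mb by metis
  moreover have "(\<Sum>e\<in>insert d I. if e = d then n else 0) = n"
    using I by simp
  ultimately have 0: "(\<Sum>e\<in>insert d I. g (b e) - (if e = d then n else 0)) = 0"
    by (simp add: sum_subtractf)
  have gb: "g (b e) \<in> gr N e" for e
    using g(1) b unfolding left_hom_def by blast
  have "g (b d) - (if d = d then n else 0) = 0"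
    by (rule graded_group_indep[OF N, of "insert d I" "\<lambda>e. g (b e) - (if e = d then n else 0)"])
      (use I 0 gb n graded_group_diff[OF N] graded_group_zero[OF N] in auto)
  then have "g (b d) = n" by simp
  then show ?thesis using b by blast
qed

lemma carr_mult:
  assumes R: "graded_superring R" and r: "r \<in> carr R" and s: "s \<in> carr R"
  shows "r * s \<in> carr R"
proof -
  have G: "graded_group R" using R unfolding graded_superring_def by blast
  show ?thesis
    using G r
  proof (induction rule: carr_induct)
    case (hom d r)
    show ?case
      using G s
    proof (induction rule: carr_induct)
      case (hom e s)
      then have "r * s \<in> R (d + e)"
        using \<open>r \<in> R d\<close> R unfolding graded_superring_def by blast
      then show ?case by (rule in_carr)
    next
      case (add x y)
      then show ?case by (simp add: distrib_left carr_add[OF G])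
    qed
  next
    case (add x y)
    then show ?case by (simp add: distrib_right carr_add[OF G])
  qed
qed

lemma
  assumes "graded_left_module R M"
  shows lact_graded: "r \<in> R d \<Longrightarrow> x \<in> gr M e \<Longrightarrow> lact M r x \<in> gr M (d + e)"
    and lact_add_right: "r \<in> carr R \<Longrightarrow> x \<in> carr (gr M) \<Longrightarrow> y \<in> carr (gr M) \<Longrightarrow>
      lact M r (x + y) = lact M r x + lact M r y"
    and lact_add_left: "r \<in> carr R \<Longrightarrow> s \<in> carr R \<Longrightarrow> x \<in> carr (gr M) \<Longrightarrow>
      lact M (r + s) x = lact M r x + lact M s x"
    and lact_mult: "r \<in> carr R \<Longrightarrow> s \<in> carr R \<Longrightarrow> x \<in> carr (gr M) \<Longrightarrow>
      lact M (r * s) x = lact M r (lact M s x)"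
    and lact_one: "x \<in> carr (gr M) \<Longrightarrow> lact M 1 x = x"
    and graded_left_moduleD: "graded_group (gr M)"
  using assms unfolding graded_left_module_def by blast+

lemma lact_zero_left:
  "graded_left_module R M \<Longrightarrow> x \<in> carr (gr M) \<Longrightarrow> lact M 0 x = 0"
  using lact_add_left[of R M 0 0 x] by (simp add: carr_zero)

lemma lact_zero_right:
  "graded_left_module R M \<Longrightarrow> r \<in> carr R \<Longrightarrow> lact M r 0 = 0"
  using lact_add_right[of R M r 0 0] by (simp add: carr_zero)

lemma lact_carr:
  assumes G: "graded_group R" and M: "graded_left_module R M"
    and r: "r \<in> carr R" and x: "x \<in> carr (gr M)"
  shows "lact M r x \<in> carr (gr M)"
  using G r
proof (induction rule: carr_induct)
  case (hom d r)
  show ?case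
    using graded_left_moduleD[OF M] x
  proof (induction rule: carr_induct)
    case (hom e x)
    have "lact M r x \<in> gr M (d + e)"
      using lact_graded[OF M \<open>r \<in> R d\<close> hom] .
    then show ?case by (rule in_carr)
  next
    case (add x y)
    then show ?case
      using lact_add_right[OF M in_carr[of r R d, OF \<open>r \<in> R d\<close>]] carr_add[OF graded_left_moduleD[OF M]]
      by simp
  qed
next
  case (add r s)
  then show ?case
    using lact_add_left[OF M] x carr_add[OF graded_left_moduleD[OF M]] by simp
qed

context
  fixes R :: "'l::ab_group_add \<times> bit \<Rightarrow> 'r::{ring, monoid_mult} set"
    and H :: "'m set" and deg :: "'m \<Rightarrow> 'l \<times> bit"
begin

definition free_gmod :: "('l, 'r, 'm \<Rightarrow> 'r) gmod" where
  "free_gmod =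
     \<lparr>gr = (\<lambda>d. {c. finite {h. c h \<noteq> 0} \<and> {h. c h \<noteq> 0} \<subseteq> H \<and> (\<forall>h. c h \<in> R (d - deg h))}),
      lact = (\<lambda>r c h. r * c h)\<rparr>"

definition free_map :: "('l, 'r, 'n::ab_group_add, 'z) gmod_scheme \<Rightarrow> ('m \<Rightarrow> 'n) \<Rightarrow> ('m \<Rightarrow> 'r) \<Rightarrow> 'n"
  where "free_map M m c = (\<Sum>h | c h \<noteq> 0. lact M (c h) (m h))"

lemma sum_fun_apply: "(\<Sum>i\<in>I. c i) h = (\<Sum>i\<in>I. (c i :: 'b \<Rightarrow> 'c::comm_monoid_add) h)"
  by (induction I rule: infinite_finite_induct) auto

lemma free_graded_group:
  assumes "graded_group R"
  shows "graded_group (gr free_gmod)"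
  unfolding graded_group_def
proof (intro conjI allI impI ballI)
  fix d
  show "0 \<in> gr free_gmod d"
    using graded_group_zero[OF assms] by (simp add: free_gmod_def)
  fix x y :: "'m \<Rightarrow> 'r"
  assume x: "x \<in> gr free_gmod d" and y: "y \<in> gr free_gmod d"
  have sub: "{h. (x - y) h \<noteq> 0} \<subseteq> {h. x h \<noteq> 0} \<union> {h. y h \<noteq> 0}" by auto
  show "x - y \<in> gr free_gmod d"
  proof -
    have "finite {h. (x - y) h \<noteq> 0}"
      by (rule finite_subset[OF sub]) (use x y in \<open>simp add: free_gmod_def\<close>)
    moreover have "{h. (x - y) h \<noteq> 0} \<subseteq> H"
      using sub x y unfolding free_gmod_def by auto
    moreover have "(x - y) h \<in> R (d - deg h)" for h
      using x y graded_group_diff[OF assms] unfolding free_gmod_def by simp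
    ultimately show ?thesis unfolding free_gmod_def by simp
  qed
next
  fix I and x :: "'l \<times> bit \<Rightarrow> 'm \<Rightarrow> 'r" and d
  assume I: "finite I" "\<forall>d\<in>I. x d \<in> gr free_gmod d" "(\<Sum>d\<in>I. x d) = 0" and d: "d \<in> I"
  show "x d = 0"
  proof
    fix h
    have "(\<Sum>e\<in>(\<lambda>d. d - deg h) ` I. x (e + deg h) h) = (\<Sum>d\<in>I. x d h)"
      by (subst sum.reindex) (auto intro: inj_onI)
    also have "\<dots> = 0"
      using I(3) sum_fun_apply[of x I h] by simp
    finally have "x ((d - deg h) + deg h) h = 0"
      by (rule graded_group_indep[OF assms, of "(\<lambda>d. d - deg h) ` I" "\<lambda>e. x (e + deg h) h", rotated 2])
        (use I d in \<open>auto simp: free_gmod_def\<close>)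
    then show "x d h = 0 h" by simp
  qed
qed

lemma free_carr:
  assumes "graded_group R" "c \<in> carr (gr free_gmod)"
  shows "finite {h. c h \<noteq> 0} \<and> {h. c h \<noteq> 0} \<subseteq> H \<and> (\<forall>h. c h \<in> carr R)"
  using free_graded_group[OF assms(1)] assms(2)
proof (induction rule: carr_induct)
  case (hom d c)
  then show ?case by (auto simp: free_gmod_def intro: in_carr)
next
  case (add x y)
  have sub: "{h. (x + y) h \<noteq> 0} \<subseteq> {h. x h \<noteq> 0} \<union> {h. y h \<noteq> 0}" by auto
  have "finite {h. (x + y) h \<noteq> 0}"
    by (rule finite_subset[OF sub]) (use add in simp)
  moreover have "{h. (x + y) h \<noteq> 0} \<subseteq> H"
    using sub add by blast
  moreover have "(x + y) h \<in> carr R" for h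
    using add carr_add[OF assms(1)] by simp
  ultimately show ?case by blast
qed

lemma free_graded_left_module:
  assumes R: "graded_superring R"
  shows "graded_left_module R free_gmod"
proof -
  have G: "graded_group R" using R unfolding graded_superring_def by blast
  have act: "lact free_gmod r x \<in> gr free_gmod (d + e)"
    if "r \<in> R d" "x \<in> gr free_gmod e" for r x d e
  proof -
    have sub: "{h. r * x h \<noteq> 0} \<subseteq> {h. x h \<noteq> 0}" by auto
    have "r * x h \<in> R (d + e - deg h)" for h
    proof -
      have xh: "x h \<in> R (e - deg h)" using that(2) by (simp add: free_gmod_def)
      have "r * x h \<in> R (d + (e - deg h))"
        using R that(1) xh unfolding graded_superring_def by blast
      then show ?thesis by (simp add: algebra_simps)
    qed
    then show ?thesis
      using that sub finite_subset[OF sub] by (auto simp: free_gmod_def)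
  qed
  show ?thesis
    unfolding graded_left_module_def
    using free_graded_group[OF G] act
    by (auto simp: free_gmod_def algebra_simps fun_eq_iff)
qed

lemma free_map_hom:
  assumes R: "graded_superring R" and M: "graded_left_module R M"
    and m: "\<And>h. h \<in> H \<Longrightarrow> m h \<in> gr M (deg h)"
  shows "left_hom R free_gmod M (free_map M m)"
proof -
  have G: "graded_group R" using R unfolding graded_superring_def by blast
  have GM: "graded_group (gr M)" using M unfolding graded_left_module_def by blast
  note l0 = lact_zero_left[OF M]
  have mc: "m h \<in> carr (gr M)" if "h \<in> H" for h
    using m[OF that] by (rule in_carr)
  note lc = lact_carr[OF G M]
  have ext: "free_map M m c = (\<Sum>h\<in>S. lact M (c h) (m h))"
    if "finite S" "S \<subseteq> H" "{h. c h \<noteq> 0} \<subseteq> S" for S and c :: "'m \<Rightarrow> 'r"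
    unfolding free_map_def
    by (rule sum.mono_neutral_left) (use that l0 mc in auto)
  show ?thesis
    unfolding left_hom_def
  proof (intro conjI allI ballI)
    fix x y assume x: "x \<in> carr (gr free_gmod)" and y: "y \<in> carr (gr free_gmod)"
    let ?S = "{h. x h \<noteq> 0} \<union> {h. y h \<noteq> 0}"
    note fx = free_carr[OF G x] and fy = free_carr[OF G y]
    have S: "finite ?S" "?S \<subseteq> H" using fx fy by auto
    have "free_map M m (x + y) = (\<Sum>h\<in>?S. lact M (x h + y h) (m h))"
      by (subst ext[OF S]) auto
    also have "\<dots> = (\<Sum>h\<in>?S. lact M (x h) (m h) + lact M (y h) (m h))"
    proof (rule sum.cong[OF refl])
      fix h assume "h \<in> ?S"
      then have "m h \<in> carr (gr M)" using mc S(2) by blast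
      moreover have "x h \<in> carr R" "y h \<in> carr R" using fx fy by auto
      ultimately show "lact M (x h + y h) (m h) = lact M (x h) (m h) + lact M (y h) (m h)"
        using lact_add_left[OF M] by blast
    qed
    also have "\<dots> = free_map M m x + free_map M m y"
      by (simp add: sum.distrib ext[OF S, of x] ext[OF S, of y])
    finally show "free_map M m (x + y) = free_map M m x + free_map M m y" .
  next
    fix d
    show "free_map M m ` gr free_gmod d \<subseteq> gr M d"
    proof safe
      fix c assume c: "c \<in> gr free_gmod d"
      have "lact M (c h) (m h) \<in> gr M d" if "c h \<noteq> 0" for h
      proof -
        have "c h \<in> R (d - deg h)" "h \<in> H" using c that by (auto simp: free_gmod_def)
        then have "lact M (c h) (m h) \<in> gr M (d - deg h + deg h)"
          using lact_graded[OF M] m by blast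
        then show ?thesis by simp
      qed
      then show "free_map M m c \<in> gr M d"
        unfolding free_map_def by (intro graded_group_sum[OF GM]) auto
    qed
  next
    fix r x assume r: "r \<in> carr R" and x: "x \<in> carr (gr free_gmod)"
    let ?S = "{h. x h \<noteq> 0}"
    note fx = free_carr[OF G x]
    have S: "finite ?S" "?S \<subseteq> H" using fx by auto
    note radd = lact_add_right[OF M r]
    have rsum: "lact M r (\<Sum>h\<in>T. z h) = (\<Sum>h\<in>T. lact M r (z h))"
      if "\<And>h. h \<in> T \<Longrightarrow> z h \<in> carr (gr M)" for T and z :: "'m \<Rightarrow> _"
      using that by (induction T rule: infinite_finite_induct) (auto simp: lact_zero_right[OF M r] radd carr_sum[OF GM])
    have "free_map M m (lact free_gmod r x) = (\<Sum>h\<in>?S. lact M (r * x h) (m h))"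
      by (subst ext[OF S]) (auto simp: free_gmod_def)
    also have "\<dots> = (\<Sum>h\<in>?S. lact M r (lact M (x h) (m h)))"
    proof (rule sum.cong[OF refl])
      fix h assume "h \<in> ?S"
      then have "m h \<in> carr (gr M)" using mc S(2) by blast
      moreover have "x h \<in> carr R" using fx by auto
      ultimately show "lact M (r * x h) (m h) = lact M r (lact M (x h) (m h))"
        using lact_mult[OF M r] by blast
    qed
    also have "\<dots> = lact M r (\<Sum>h\<in>?S. lact M (x h) (m h))"
      by (rule rsum[symmetric]) (use lc mc S fx in blast)
    finally show "free_map M m (lact free_gmod r x) = lact M r (free_map M m x)"
      by (simp add: free_map_def)
  qed
qed

end

lemma projective_lifts_through:
  fixes R :: "'l::ab_group_add \<times> bit \<Rightarrow> 'r::{ring, monoid_mult} set"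
    and P :: "('l, 'r, 'm::ab_group_add, 'z) gmod_scheme"
    and M :: "('l, 'r, 'n::ab_group_add) gmod" and N :: "('l, 'r, 'k::ab_group_add) gmod"
  assumes R: "graded_superring R" and P: "graded_left_module R P" and proj: "projective R P"
  shows "lifts_through R P M N"
  unfolding lifts_through_def
proof (intro impI allI)
  fix g f
  assume M: "graded_left_module R M" and N: "graded_left_module R N"
    and gf: "left_hom R M N g \<and> g ` carr (gr M) = carr (gr N) \<and> left_hom R P N f"
  have G: "graded_group R" and one: "1 \<in> R 0" using R unfolding graded_superring_def by blast+
  have GM: "graded_group (gr M)" and GN: "graded_group (gr N)" and GP: "graded_group (gr P)"
    using M N P unfolding graded_left_module_def by blast+
  define H where "H = {h. h \<noteq> 0 \<and> (\<exists>d. h \<in> gr P d)}"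
  define deg where "deg = (\<lambda>h. SOME d. h \<in> gr P d)"
  have deg: "h \<in> gr P (deg h)" if "h \<in> H" for h
    
  proof -
    have "\<exists>d. h \<in> gr P d" using that unfolding H_def by blast
    then show ?thesis unfolding deg_def by (rule someI_ex)
  qed
  let ?F = "free_gmod R H deg"
  let ?P = "\<lparr>gr = gr P, lact = lact P\<rparr>"
  have P': "graded_left_module R ?P" using P unfolding graded_left_module_def by simp
  have F: "graded_left_module R ?F" by (rule free_graded_left_module[OF R])
  have GF: "graded_group (gr ?F)" using F unfolding graded_left_module_def by blast
  define eps where "eps = free_map ?P (\<lambda>h. h)"
  have eps: "left_hom R ?F ?P eps"
    unfolding eps_def by (rule free_map_hom[OF R P']) (use deg in simp)
  have single: "\<exists>c\<in>carr (gr ?F). eps c = h" if "h \<in> gr P d" for h d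
  proof (cases "h = 0")
    case True
    have "eps 0 = 0" by (simp add: eps_def free_map_def)
    then show ?thesis using True carr_zero[of "gr ?F"] by blast
  next
    case False
    then have h: "h \<in> H" using that unfolding H_def by blast
    show ?thesis
    proof (cases "(1::'r) = 0")
      case True
      then have "lact P 1 h = lact P 0 h" by simp
      moreover have "lact P 1 h = h" "lact P 0 h = 0"
      proof -
        have "h \<in> carr (gr P)" using that by (rule in_carr)
        then show "lact P 1 h = h" "lact P 0 h = 0"
          using lact_one[OF P] lact_zero_left[OF P] by blast+
      qed
      ultimately show ?thesis using False by simp
    next
      case one0: False
      let ?c = "\<lambda>k. if k = h then 1 else 0 :: 'r"
      have supp: "{k. ?c k \<noteq> 0} = {h}" using one0 by auto
      have "?c \<in> gr ?F (deg h)"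
        using h one graded_group_zero[OF G] one0 by (simp add: free_gmod_def)
      moreover have "eps ?c = h"
        unfolding eps_def free_map_def supp
        using lact_one[OF P in_carr[of h "gr P" d, OF that]] by simp
      ultimately show ?thesis using in_carr[of ?c "gr ?F" "deg h"] by blast
    qed
  qed
  have surj: "eps ` carr (gr ?F) = carr (gr ?P)"
  proof safe
    fix c assume "c \<in> carr (gr ?F)"
    then show "eps c \<in> carr (gr ?P)"
      using left_hom_carr[OF eps GF] GP by simp
  next
    fix x assume x: "x \<in> carr (gr ?P)"
    then have "x \<in> carr (gr P)" by simp
    with GP have "\<exists>c\<in>carr (gr ?F). eps c = x"
    proof (induction rule: carr_induct)
      case (hom d x)
      then show ?case by (rule single)
    next
      case (add x y)
      then obtain c b where "c \<in> carr (gr ?F)" "b \<in> carr (gr ?F)" "eps c = x" "eps b = y" by blast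
      then show ?case
        using eps carr_add[OF GF, of c b] unfolding left_hom_def by metis
    qed
    then show "x \<in> eps ` carr (gr ?F)" by blast
  qed
  have "left_hom R P ?P (\<lambda>x. x)" unfolding left_hom_def by simp
  then obtain s where s: "left_hom R P ?F s" "\<forall>x\<in>carr (gr P). eps (s x) = x"
    using proj F P' eps surj unfolding projective_def lifts_through_def by meson
  have "\<exists>m. m \<in> gr M (deg h) \<and> g m = f h" if "h \<in> H" for h
  proof -
    have "f h \<in> gr N (deg h)" using gf deg[OF that] unfolding left_hom_def by blast
    then have "\<exists>m\<in>gr M (deg h). g m = f h"
      by (rule homogeneous_preimage[OF GM GN conjunct1[OF gf] conjunct1[OF conjunct2[OF gf]]])
    then show ?thesis by blast
  qed
  then obtain m where m: "\<And>h. h \<in> H \<Longrightarrow> m h \<in> gr M (deg h)" "\<And>h. h \<in> H \<Longrightarrow> g (m h) = f h"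
    by metis
  let ?k = "free_map M m"
  have k: "left_hom R ?F M ?k" by (rule free_map_hom[OF R M m(1)])
  have sc: "s x \<in> carr (gr ?F)" if "x \<in> carr (gr P)" for x
    by (rule left_hom_carr[OF s(1) GP GF that])
  have "left_hom R P M (\<lambda>x. ?k (s x))"
    using s(1) k sc unfolding left_hom_def by (auto simp: image_subset_iff)
  moreover have "g (?k (s x)) = f x" if x: "x \<in> carr (gr P)" for x
  proof -
    let ?S = "{h. s x h \<noteq> 0}"
    note fs = free_carr[OF G sc[OF x]]
    have hH: "h \<in> H" if "h \<in> ?S" for h using fs that by blast
    have mM: "m h \<in> carr (gr M)" and hP: "h \<in> carr (gr P)" if "h \<in> ?S" for h
      using m(1)[OF hH[OF that]] deg[OF hH[OF that]] by (auto intro: in_carr)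
    have "g (?k (s x)) = (\<Sum>h\<in>?S. g (lact M (s x h) (m h)))"
      unfolding free_map_def
      by (rule left_hom_sum) (use gf GM mM fs in \<open>auto intro: lact_carr[OF G M]\<close>)
    also have "\<dots> = (\<Sum>h\<in>?S. lact N (s x h) (f h))"
    proof (rule sum.cong[OF refl])
      fix h assume "h \<in> ?S"
      then have h: "h \<in> H" by (rule hH)
      have "m h \<in> carr (gr M)" using m(1)[OF h] by (rule in_carr)
      moreover have "s x h \<in> carr R" using fs by blast
      ultimately
      show "g (lact M (s x h) (m h)) = lact N (s x h) (f h)"
        using gf m(2)[OF h] unfolding left_hom_def by auto
    qed
    also have "\<dots> = (\<Sum>h\<in>?S. f (lact P (s x h) h))"
    proof (rule sum.cong[OF refl])
      fix h assume "h \<in> ?S"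
      then have h: "h \<in> H" by (rule hH)
      have "h \<in> carr (gr P)" using deg[OF h] by (rule in_carr)
      moreover have "s x h \<in> carr R" using fs by blast
      ultimately
      show "lact N (s x h) (f h) = f (lact P (s x h) h)"
        using gf unfolding left_hom_def by auto
    qed
    also have "\<dots> = f (\<Sum>h\<in>?S. lact P (s x h) h)"
      by (rule left_hom_sum[symmetric]) (use gf GP hP fs in \<open>auto intro: lact_carr[OF G P]\<close>)
    also have "(\<Sum>h\<in>?S. lact P (s x h) h) = x"
      using s(2) x by (simp add: eps_def free_map_def)
    finally show ?thesis .
  qed
  ultimately show "\<exists>h. left_hom R P M h \<and> (\<forall>x\<in>carr (gr P). g (h x) = f x)" by blast
qed

section \<open>Frobenius extensions\<close>

text \<open>
  \<open>A\<close>, the ring with grading \<open>GA\<close>, is an $(\alpha,\beta)$-Frobenius extension of its graded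
  subring \<open>B\<close> of degree $(-\lambda,\pi)$, where \<open>lam\<close> stands for $\lambda$.
\<close>

definition frobenius_extension ::
    "('l::ab_group_add \<times> bit \<Rightarrow> 'a::{ring, monoid_mult} set) \<Rightarrow> 'a set \<Rightarrow>
     ('a \<Rightarrow> 'a) \<Rightarrow> ('a \<Rightarrow> 'a) \<Rightarrow> 'l \<Rightarrow> bit \<Rightarrow> bool" where
  "frobenius_extension GA B \<alpha> \<beta> lam \<pi> \<longleftrightarrow>
     (let GB = restrict_grading GA B in
       finitely_generated GB (regular GA) \<and> projective GB (regular GA) \<and>
       bimod_isomorphic GA GB (regular GA)
         (HOM_L GB GA GB (twisted GA \<beta> \<alpha>) (shift GB lam \<pi> (regular GB))))"

end

theory Submission
  imports Defs
begin

text \<open>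
  If $\Phi$ is an isomorphism as in (L2), then $\mathrm{tr} = \Phi(1)$ is a homomorphism of bimodules,
  because $b \cdot \mathrm{tr} = \Phi(b) = \mathrm{tr} \cdot b$ for $b \in B$, and $\Phi(a)(x) = (-1)^{\bar a \bar x}\,
  \mathrm{tr}(x\alpha(a))$.  By (L1) there is a homogeneous dual basis $a = \sum_i c_i(a) x_i$, the maps
  $f_i(a) = (-1)^{\bar x_i \bar a + \pi \bar x_i} \beta^{-1}(c_i(a))$ belong to the bimodule of homomorphisms,
  and $y_i = \alpha(\Phi^{-1}(f_i))$ gives the first formula; the second holds because both of its sides
  have the same image under $\Phi$.  Conversely, the first formula says that
  $c_i(a) = (-1)^{\pi \bar a + \pi \bar x_i} \beta(\mathrm{tr}(a y_i))$ defines a dual basis, and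
  $f \mapsto \sum_i (-1)^{\bar x_i \bar f} \alpha^{-1}(y_i) f(x_i)$ is inverse to
  $a \mapsto a \cdot \mathrm{tr}$.
\<close>

text \<open>The obstacle throughout is signs that depend on parities of homogeneous elements, while
  all maps live on arbitrary elements. Every signed formula is therefore a sum over parity
  components; \<open>sum_par_hom\<close> collapses it on homogeneous arguments, and additivity
  carries identities to all elements. Two parities offset each other: a member of degree
  \<open>d\<close> of the bimodule of homomorphisms is a map of degree \<open>d - D\<close>, with
  \<open>D\<close> the pair of \<lambda> and \<pi>, and is linear up to the parity of
  \<open>d\<close> plus \<pi>. Thus the trace, of degree 0 there, carries exactly the sign of \<pi>,
  and a coordinate functional of degree minus that of \<open>x i\<close> lies in degree
  \<open>D - d i\<close>, which is the degree forced on \<open>y i\<close>. The inverse of \<beta>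
  enters because dual basis functionals are linear for the plain left action, whereas homomorphisms
  have the \<beta>-twisted source; \<alpha> enters \<open>y i\<close> because the left action on
  homomorphisms multiplies arguments on the right by \<alpha>(a). Both formulas rest on one
  computation, \<open>expand_by_trace\<close>: a twisted-linear map is applied to the first formula,
  and its values at the \<open>x i\<close> determine it.\<close>

text \<open>
  These library rules rewrite sums and products of parities to bitwise operations, which hides the
  field structure used to simplify exponents of signs.
\<close>

declare add_bit_eq_xor [simp del] mult_bit_eq_and [simp del]

section \<open>Signs and parity components\<close>

lemma bit_add_self [simp]: "p + p = (0 :: bit)"
  by (cases p) simp_all

lemma bit_add_left_self [simp]: "p + (p + q) = (q :: bit)"
  by (simp flip: add.assoc)

lemma bit_add_one_eq_iff: "p + 1 = (q :: bit) \<longleftrightarrow> p \<noteq> q"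
  by (cases p; cases q) simp_all

lemma psign_0 [simp]: "psign 0 x = x"
  by (simp add: psign_def)

lemma psign_zero [simp]: "psign p 0 = 0"
  by (simp add: psign_def)

lemma psign_eq_iff [simp]: "psign p x = psign p y \<longleftrightarrow> x = y"
  by (simp add: psign_def)

lemma psign_psign: "psign p (psign q x) = psign (p + q) x"
  by (cases p; cases q) (simp_all add: psign_def)

lemma psign_add: "psign p (x + y) = psign p x + psign p y"
  by (simp add: psign_def)

lemma psign_diff: "psign p (x - y) = psign p x - psign p y"
  by (simp add: psign_def)

lemma psign_sum: "psign p (\<Sum>i\<in>I. x i) = (\<Sum>i\<in>I. psign p (x i))"
  by (simp add: psign_def sum_negf)

lemma psign_mult_left: "psign p x * y = psign p (x * y)"
  for x :: "'a::ring"
  by (simp add: psign_def)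

lemma psign_mult_right: "x * psign p y = psign p (x * y)"
  for x :: "'a::ring"
  by (simp add: psign_def)

lemma psign_additive:
  assumes "\<And>x y. f (x + y) = f x + f y"
  shows "f (psign p x) = psign p (f x)"
proof -
  have "f 0 = 0" using assms[of 0 0] by simp
  moreover have "f (- x) + f x = f 0" using assms[of "- x" x] by simp
  ultimately show ?thesis by (simp add: psign_def eq_neg_iff_add_eq_0)
qed

lemma sum_additive:
  assumes "\<And>x y. f (x + y) = f x + (f y :: 'b::ab_group_add)"
  shows "f (\<Sum>i\<in>I. x i) = (\<Sum>i\<in>I. f (x i :: 'a::ab_group_add))"
proof -
  have "f 0 = 0" using assms[of 0 0] by simp
  then show ?thesis by (induction I rule: infinite_finite_induct) (simp_all add: assms)
qed

lemma psign_in: "graded_group G \<Longrightarrow> x \<in> G d \<Longrightarrow> psign p x \<in> G d"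
  using graded_group_diff[of G 0 d x] graded_group_zero[of G d] by (simp add: psign_def)

section \<open>Decomposition of a graded group into its even and odd parts\<close>

lemma graded_group_parity:
  assumes "graded_group G"
  shows "graded_group (\<lambda>l. G (l, p))"
  unfolding graded_group_def
proof (intro conjI allI impI ballI)
  fix I x l
  assume I: "finite I" "\<forall>l\<in>I. x l \<in> G (l, p)" "(\<Sum>l\<in>I. x l) = 0" and l: "l \<in> I"
  have "(\<Sum>e\<in>(\<lambda>l. (l, p)) ` I. x (fst e)) = 0"
    using I(3) by (subst sum.reindex) (auto intro: inj_onI)
  then have "x (fst (l, p)) = 0"
    by (rule graded_group_indep[OF assms, rotated 2]) (use I l in auto)
  then show "x l = 0" by simp
qed (use assms in \<open>auto intro: graded_group_zero graded_group_diff\<close>)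

text \<open>The homogeneous decompositions of \<open>u\<close> in the two parities involve disjoint
  sets of degrees. Joined with opposite signs they sum to \<open>u - u\<close>, so independence of
  the degrees kills every term.\<close>

lemma parity_disjoint:
  fixes G :: "'l \<times> bit \<Rightarrow> 'm::ab_group_add set"
  assumes G: "graded_group G" and u: "u \<in> carr (\<lambda>l. G (l, p))" and v: "u \<in> carr (\<lambda>l. G (l, p + 1))"
  shows "u = 0"
proof -
  obtain I c where I: "finite I" "\<And>l. l \<in> I \<Longrightarrow> c l \<in> G (l, p)" "u = (\<Sum>l\<in>I. c l)"
    by (rule carrE[OF u]) blast
  obtain J b where J: "finite J" "\<And>l. l \<in> J \<Longrightarrow> b l \<in> G (l, p + 1)" "u = (\<Sum>l\<in>J. b l)"
    by (rule carrE[OF v]) blast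
  let ?x = "\<lambda>(l, q). if q = p then c l else - b l"
  have ne: "p \<noteq> p + 1" "p + 1 \<noteq> p" using bit_add_one_eq_iff[of p p] by auto
  have "(\<Sum>e\<in>(\<lambda>l. (l, p)) ` I \<union> (\<lambda>l. (l, p + 1)) ` J. ?x e) =
      (\<Sum>e\<in>(\<lambda>l. (l, p)) ` I. ?x e) + (\<Sum>e\<in>(\<lambda>l. (l, p + 1)) ` J. ?x e)"
    using I(1) J(1) ne by (intro sum.union_disjoint) auto
  also have "(\<Sum>e\<in>(\<lambda>l. (l, p)) ` I. ?x e) = u"
    unfolding I(3) by (subst sum.reindex) (auto intro: inj_onI)
  also have "(\<Sum>e\<in>(\<lambda>l. (l, p + 1)) ` J. ?x e) = - u"
    unfolding J(3) using ne by (subst sum.reindex) (auto intro: inj_onI simp: sum_negf)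
  finally have 0: "(\<Sum>e\<in>(\<lambda>l. (l, p)) ` I \<union> (\<lambda>l. (l, p + 1)) ` J. ?x e) = 0" by simp
  have "- b l \<in> G (l, p + 1)" if "l \<in> J" for l
    using graded_group_diff[OF G graded_group_zero[OF G] J(2)[OF that]] by simp
  then have "?x (l, p) = 0" if "l \<in> I" for l
    by (intro graded_group_indep[OF G _ _ 0]) (use I J ne that in auto)
  then show ?thesis using I(3) by simp
qed

text \<open>This turns the definite description in \<open>par\<close> into a usable value: two
  candidates differ by an element of both parities, which is 0. Together with
  \<open>par_decomp\<close>, which supplies the splitting, it makes \<open>par\<close> additive on
  the carrier.\<close>

lemma par_eq:
  assumes G: "graded_group G" and u: "u \<in> carr (\<lambda>l. G (l, p))" and v: "v \<in> carr (\<lambda>l. G (l, p + 1))"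
  shows "par G p (u + v) = u"
  unfolding par_def
proof (rule the_equality)
  show "u \<in> carr (\<lambda>l. G (l, p)) \<and> u + v - u \<in> carr (\<lambda>l. G (l, p + 1))"
    using u v by simp
  fix y assume y: "y \<in> carr (\<lambda>l. G (l, p)) \<and> u + v - y \<in> carr (\<lambda>l. G (l, p + 1))"
  have neg: "- x \<in> carr (\<lambda>l. G (l, q))" if "x \<in> carr (\<lambda>l. G (l, q))" for x q
    using graded_group_parity[OF G] that
  proof (induction rule: carr_induct)
    case (hom d x)
    then show ?case
      using in_carr[of "- x" "\<lambda>l. G (l, q)" d] psign_in[OF G, of x "(d, q)" 1] by (simp add: psign_def)
  next
    case (add x y)
    then show ?case
      using carr_add[OF graded_group_parity[OF G], of "- x" q "- y"] by simp
  qed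
  have "y + - u \<in> carr (\<lambda>l. G (l, p))"
    by (intro carr_add[OF graded_group_parity[OF G]] neg) (use y u in auto)
  moreover have "v + - (u + v - y) \<in> carr (\<lambda>l. G (l, p + 1))"
    by (intro carr_add[OF graded_group_parity[OF G]] neg) (use y v in auto)
  ultimately have "y - u = 0"
    by (intro parity_disjoint[OF G, of "y - u" p]) auto
  then show "y = u" by simp
qed

lemma par_hom:
  assumes G: "graded_group G" and x: "x \<in> G e"
  shows "par G p x = (if p = snd e then x else 0)"
proof -
  obtain l q where e: "e = (l, q)" by (cases e)
  show ?thesis
  proof (cases "p = q")
    case True
    then have "x \<in> carr (\<lambda>l. G (l, p))" using x e in_carr[of x "\<lambda>l. G (l, p)" l] by simp
    then show ?thesis using par_eq[OF G _ carr_zero, of x p] True e by simp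
  next
    case False
    then have "p + 1 = q" by (simp only: bit_add_one_eq_iff not_False_eq_True)
    then have "x \<in> carr (\<lambda>l. G (l, p + 1))" using x e in_carr[of x "\<lambda>l. G (l, q)" l] by simp
    then show ?thesis using par_eq[OF G carr_zero, of x p] False e by simp
  qed
qed

lemma par_decomp:
  fixes G :: "'l \<times> bit \<Rightarrow> 'm::ab_group_add set"
  assumes G: "graded_group G" and x: "x \<in> carr G"
  obtains u v where "u \<in> carr (\<lambda>l. G (l, p))" "v \<in> carr (\<lambda>l. G (l, p + 1))" "x = u + v"
proof -
  have "\<exists>u v. u \<in> carr (\<lambda>l. G (l, p)) \<and> v \<in> carr (\<lambda>l. G (l, p + 1)) \<and> x = u + v"
    using G x
  proof (induction rule: carr_induct)
    case (hom d x)
    obtain l q where d: "d = (l, q)" by (cases d)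
    show ?case
    proof (cases "p = q")
      case True
      then have "x \<in> carr (\<lambda>l. G (l, p))" using hom d in_carr[of x "\<lambda>l. G (l, p)" l] by simp
      then show ?thesis using carr_zero by (intro exI[of _ x] exI[of _ 0]) auto
    next
      case False
      then have "p + 1 = q" by (simp only: bit_add_one_eq_iff not_False_eq_True)
      then have "x \<in> carr (\<lambda>l. G (l, p + 1))" using hom d in_carr[of x "\<lambda>l. G (l, q)" l] by simp
      then show ?thesis using carr_zero by (intro exI[of _ 0] exI[of _ x]) auto
    qed
  next
    case (add x y)
    then obtain u v u' v' where
      "u \<in> carr (\<lambda>l. G (l, p))" "v \<in> carr (\<lambda>l. G (l, p + 1))" "x = u + v"
      "u' \<in> carr (\<lambda>l. G (l, p))" "v' \<in> carr (\<lambda>l. G (l, p + 1))" "y = u' + v'" by blast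
    then show ?case
      using carr_add[OF graded_group_parity[OF G]]
      by (intro exI[of _ "u + u'"] exI[of _ "v + v'"]) (auto simp: algebra_simps)
  qed
  then show thesis using that by blast
qed

lemma par_add:
  assumes G: "graded_group G" and x: "x \<in> carr G" and y: "y \<in> carr G"
  shows "par G p (x + y) = par G p x + par G p y"
proof -
  obtain u v where u: "u \<in> carr (\<lambda>l. G (l, p))" "v \<in> carr (\<lambda>l. G (l, p + 1))" "x = u + v"
    by (rule par_decomp[OF G x])
  obtain u' v' where u': "u' \<in> carr (\<lambda>l. G (l, p))" "v' \<in> carr (\<lambda>l. G (l, p + 1))" "y = u' + v'"
    by (rule par_decomp[OF G y])
  have "par G p ((u + u') + (v + v')) = u + u'"
    using u u' by (intro par_eq[OF G] carr_add[OF graded_group_parity[OF G]]) auto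
  then show ?thesis
    using par_eq[OF G u(1,2)] par_eq[OF G u'(1,2)] u(3) u'(3) by (simp add: algebra_simps)
qed

lemma par_carr:
  assumes G: "graded_group G" and x: "x \<in> carr G"
  shows "par G p x \<in> carr G"
  using assms
proof (induction rule: carr_induct)
  case (hom d x)
  then show ?case using par_hom[OF G hom] in_carr[of x G d] carr_zero[of G] by simp
next
  case (add x y)
  then show ?case using par_add[OF G] carr_add[OF G] by simp
qed

lemma sum_bit: "(\<Sum>p\<in>{0, 1}. g p) = g 0 + g (1 :: bit)"
  by simp

text \<open>Only the summand at the parity of \<open>x\<close> survives. This recovers the usual
  homogeneous sign rule from a formula extended additively over parities.\<close>

lemma sum_par_hom:
  assumes G: "graded_group G" and x: "x \<in> G e" and f: "\<And>p. f p 0 = 0"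
  shows "(\<Sum>p\<in>{0, 1}. f p (par G p x)) = f (snd e) x"
proof -
  have *: "f p (par G p x) = 0" if "p \<noteq> snd e" for p
    using f[of p] unfolding par_hom[OF G x, of p] if_not_P[OF that] .
  have "f (snd e) (par G (snd e) x) = f (snd e) x"
    unfolding par_hom[OF G x, of "snd e"] if_P[OF refl] ..
  moreover have "snd e = 0 \<or> snd e = 1" by (cases "snd e") auto
  ultimately show ?thesis
    using *[of 0] *[of 1] unfolding sum_bit by (metis add_0_left add_0_right zero_neq_one)
qed

section \<open>Homomorphisms of graded modules\<close>

text \<open>The kernel of a degree-preserving map is graded: the images of the components of a
  kernel element lie in distinct degrees and sum to 0, so each component is already in the
  kernel.\<close>

lemma left_hom_inj_on:
  assumes f: "left_hom R M N f" and M: "graded_group (gr M)" and N: "graded_group (gr N)"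
    and ker: "\<And>d x. x \<in> gr M d \<Longrightarrow> f x = 0 \<Longrightarrow> x = 0"
  shows "inj_on f (carr (gr M))"
proof (rule inj_onI)
  have neg: "- y \<in> carr (gr M)" if "y \<in> carr (gr M)" for y
    using M that
  proof (induction rule: carr_induct)
    case (hom d y)
    then show ?case using psign_in[OF M, of y d 1] in_carr[of "- y" "gr M" d] by (simp add: psign_def)
  next
    case (add x y)
    then show ?case using carr_add[OF M, of "- x" "- y"] by simp
  qed
  fix x y assume x: "x \<in> carr (gr M)" and y: "y \<in> carr (gr M)" and eq: "f x = f y"
  have xy: "x + - y \<in> carr (gr M)" using x neg[OF y] by (rule carr_add[OF M])
  have "f (x + - y + y) = f (x + - y) + f y"
    using f xy y unfolding left_hom_def by blast
  then have f0: "f (x + - y) = 0" using eq by simp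
  obtain I c where I: "finite I" "\<And>d. d \<in> I \<Longrightarrow> c d \<in> gr M d" "x + - y = (\<Sum>d\<in>I. c d)"
    by (rule carrE[OF xy]) blast
  have "(\<Sum>d\<in>I. f (c d)) = f (\<Sum>d\<in>I. c d)"
    by (rule left_hom_sum[OF f M, symmetric]) (use I in \<open>auto intro: in_carr\<close>)
  then have 0: "(\<Sum>d\<in>I. f (c d)) = 0" using f0 I(3) by simp
  have "f (c d) = 0" if "d \<in> I" for d
    by (rule graded_group_indep[OF N I(1) _ 0 that]) (use I f in \<open>auto simp: left_hom_def image_subset_iff\<close>)
  then have "c d = 0" if "d \<in> I" for d using ker I that by blast
  then show "x = y" using I(3) by simp
qed

lemma left_hom_image:
  assumes f: "left_hom R M N f" and M: "graded_group (gr M)" and N: "graded_group (gr N)"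
    and surj: "\<And>d y. y \<in> gr N d \<Longrightarrow> \<exists>x\<in>carr (gr M). f x = y"
  shows "f ` carr (gr M) = carr (gr N)"
proof safe
  fix x assume "x \<in> carr (gr M)"
  then show "f x \<in> carr (gr N)" by (rule left_hom_carr[OF f M N])
next
  fix y assume "y \<in> carr (gr N)"
  with N show "y \<in> f ` carr (gr M)"
  proof (induction rule: carr_induct)
    case (hom d y)
    then show ?case using surj by blast
  next
    case (add y z)
    then obtain u v where "u \<in> carr (gr M)" "v \<in> carr (gr M)" "f u = y" "f v = z" by blast
    then show ?case using f carr_add[OF M, of u v] unfolding left_hom_def by (metis image_eqI)
  qed
qed

text \<open>An automorphism is only assumed to map each degree into itself; surjectivity on the
  whole ring forces it onto each degree, so its inverse is graded as well.\<close>

lemma graded_automorphism_preimage: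
  fixes R :: "'l \<times> bit \<Rightarrow> 'r::{ring, monoid_mult} set"
  assumes R: "graded_group R" and f: "graded_automorphism R f" and x: "x \<in> R d"
  shows "\<exists>y\<in>R d. f y = x"
proof -
  \<comment> \<open>A ring automorphism is not linear over the ring. With scalars acting as the
    identity, linearity becomes trivial and the preimage lemma for modules applies.\<close>
  let ?M = "\<lparr>gr = R, lact = (\<lambda>r x. x)\<rparr>"
  have "left_hom R ?M ?M f"
    using f by (simp add: left_hom_def graded_automorphism_def)
  moreover have "f ` carr R = carr R"
    using f by (simp add: graded_automorphism_def bij_betw_def)
  ultimately show ?thesis
    using homogeneous_preimage[of ?M ?M R f x d] R x by simp
qed

section \<open>Graded dual bases\<close>

text \<open>Coordinates as in the dual basis lemma, with \<open>c i\<close> of degree minus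
  \<open>d i\<close> so that each term of the expansion has the degree of \<open>x\<close>.
  Linearity is strict, as in \<open>left_hom\<close>; the signs of homomorphisms of nonzero degree
  are inserted only later. Indexing by numbers permits repeated generators.\<close>

definition dual_basis ::
    "('l::ab_group_add \<times> bit \<Rightarrow> 'r::ring set) \<Rightarrow> ('l, 'r, 'm::ab_group_add, 'z) gmod_scheme \<Rightarrow>
     nat \<Rightarrow> (nat \<Rightarrow> 'm) \<Rightarrow> (nat \<Rightarrow> 'l \<times> bit) \<Rightarrow> (nat \<Rightarrow> 'm \<Rightarrow> 'r) \<Rightarrow> bool" where
  "dual_basis R P n m d c \<longleftrightarrow>
     (\<forall>i<n. m i \<in> gr P (d i) \<and>
        (\<forall>x\<in>carr (gr P). \<forall>y\<in>carr (gr P). c i (x + y) = c i x + c i y) \<and>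
        (\<forall>e. \<forall>x\<in>gr P e. c i x \<in> R (e - d i)) \<and>
        (\<forall>r\<in>carr R. \<forall>x\<in>carr (gr P). c i (lact P r x) = r * c i x)) \<and>
     (\<forall>x\<in>carr (gr P). x = (\<Sum>i<n. lact P (c i x) (m i)))"

text \<open>Each generator is replaced by its homogeneous components, which again form a finite
  generating set.\<close>

lemma finitely_generated_homogeneous:
  fixes R :: "'l::ab_group_add \<times> bit \<Rightarrow> 'r::{ring, monoid_mult} set"
    and P :: "('l, 'r, 'm::ab_group_add, 'z) gmod_scheme"
  assumes R: "graded_group R" and P: "graded_left_module R P" and fg: "finitely_generated R P"
  shows "\<exists>T. finite T \<and> (\<forall>t\<in>T. \<exists>d. t \<in> gr P d) \<and>
    (\<forall>x\<in>carr (gr P). \<exists>c. (\<forall>t\<in>T. c t \<in> carr R) \<and> x = (\<Sum>t\<in>T. lact P (c t) t))"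
proof -
  obtain S where S: "finite S" "S \<subseteq> carr (gr P)"
    and gen: "\<And>x. x \<in> carr (gr P) \<Longrightarrow> \<exists>c. (\<forall>s\<in>S. c s \<in> carr R) \<and> x = (\<Sum>s\<in>S. lact P (c s) s)"
    using fg unfolding finitely_generated_def by blast
  have "\<exists>I b. finite I \<and> (\<forall>d\<in>I. b d \<in> gr P d) \<and> s = (\<Sum>d\<in>I. b d)" if "s \<in> S" for s
    using S(2) that unfolding carr_def by blast
  then obtain I b where I: "\<And>s. s \<in> S \<Longrightarrow> finite (I s) \<and> (\<forall>d\<in>I s. b s d \<in> gr P d) \<and> s = (\<Sum>d\<in>I s. b s d)"
    by metis
  define T where "T = (\<lambda>(s, d). b s d) ` Sigma S I"
  have T: "finite T" unfolding T_def using S(1) I by blast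
  have Thom: "\<exists>d. t \<in> gr P d" if "t \<in> T" for t using that I unfolding T_def by auto
  have TP: "t \<in> carr (gr P)" if "t \<in> T" for t using Thom[OF that] by (auto intro: in_carr)
  have "\<exists>c. (\<forall>t\<in>T. c t \<in> carr R) \<and> x = (\<Sum>t\<in>T. lact P (c t) t)" if x: "x \<in> carr (gr P)" for x
  proof -
    obtain c where c: "\<And>s. s \<in> S \<Longrightarrow> c s \<in> carr R" "x = (\<Sum>s\<in>S. lact P (c s) s)" using gen[OF x] by blast
    have lsum: "lact P r (\<Sum>j\<in>J. z j) = (\<Sum>j\<in>J. lact P r (z j))"
      if "r \<in> carr R" "\<And>j. j \<in> J \<Longrightarrow> z j \<in> carr (gr P)" for r J and z :: "'l \<times> bit \<Rightarrow> 'm"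
      using that
      by (induction J rule: infinite_finite_induct)
        (auto simp: lact_zero_right[OF P] lact_add_right[OF P] carr_sum[OF graded_left_moduleD[OF P]])
    have rsum: "lact P (\<Sum>j\<in>J. z j) t = (\<Sum>j\<in>J. lact P (z j) t)"
      if "t \<in> carr (gr P)" "\<And>j. j \<in> J \<Longrightarrow> z j \<in> carr R" for t J and z :: "'m \<times> 'l \<times> bit \<Rightarrow> 'r"
      using that
      by (induction J rule: infinite_finite_induct)
        (auto simp: lact_zero_left[OF P] lact_add_left[OF P] carr_sum[OF R])
    have "x = (\<Sum>s\<in>S. \<Sum>d\<in>I s. lact P (c s) (b s d))"
      unfolding c(2)
    proof (rule sum.cong[OF refl])
      fix s assume s: "s \<in> S"
      have "lact P (c s) s = lact P (c s) (\<Sum>d\<in>I s. b s d)" using I[OF s] by simp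
      also have "\<dots> = (\<Sum>d\<in>I s. lact P (c s) (b s d))"
        using c(1)[OF s] I[OF s] by (intro lsum) (auto intro: in_carr)
      finally show "lact P (c s) s = (\<Sum>d\<in>I s. lact P (c s) (b s d))" .
    qed
    also have "\<dots> = (\<Sum>j\<in>Sigma S I. lact P (c (fst j)) (b (fst j) (snd j)))"
      using S(1) I by (subst sum.Sigma) (auto simp: split_beta)
    \<comment> \<open>Different pairs of a generator and a degree can give the same component
      \<open>t\<close>, so the coefficients are collected over the fibres of the map onto
      \<open>T\<close>.\<close>
    also have "\<dots> = (\<Sum>t\<in>T. \<Sum>j | j \<in> Sigma S I \<and> b (fst j) (snd j) = t. lact P (c (fst j)) (b (fst j) (snd j)))"
      using S(1) I T by (intro sum.group[symmetric]) (auto simp: T_def)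
    also have "\<dots> = (\<Sum>t\<in>T. lact P (\<Sum>j | j \<in> Sigma S I \<and> b (fst j) (snd j) = t. c (fst j)) t)"
      using TP c(1) by (intro sum.cong refl) (subst rsum, auto)
    finally show ?thesis
      using c(1) by (intro exI conjI ballI) (auto intro: carr_sum[OF R])
  qed
  then show ?thesis using T Thom by blast
qed

text \<open>A finite homogeneous generating set yields a graded free cover of finite rank;
  projectivity splits it, and the coordinates of the splitting are the functionals sought.\<close>

lemma dual_basis_exists:
  fixes P :: "('l::ab_group_add, 'r::{ring, monoid_mult}, 'm::ab_group_add, 'z) gmod_scheme"
  assumes R: "graded_superring R" and P: "graded_left_module R P"
    and fg: "finitely_generated R P" and proj: "projective R P"
  shows "\<exists>n m d c. dual_basis R P n m d c"
proof -
  have G: "graded_group R" and one: "1 \<in> R 0" using R unfolding graded_superring_def by blast+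
  obtain T where T: "finite T" "\<And>t. t \<in> T \<Longrightarrow> \<exists>d. t \<in> gr P d"
    and gen: "\<And>x. x \<in> carr (gr P) \<Longrightarrow> \<exists>c. (\<forall>t\<in>T. c t \<in> carr R) \<and> x = (\<Sum>t\<in>T. lact P (c t) t)"
    using finitely_generated_homogeneous[OF G P fg] by blast
  obtain deg where deg: "\<And>t. t \<in> T \<Longrightarrow> t \<in> gr P (deg t)" using T(2) by metis
  have TP: "t \<in> carr (gr P)" if "t \<in> T" for t using deg[OF that] by (rule in_carr)
  let ?F = "free_gmod R T deg"
  \<comment> \<open>\<open>projective\<close> quantifies over plain left module records, so any
    additional fields of \<open>P\<close>, such as a right action, are dropped.\<close>
  let ?P = "\<lparr>gr = gr P, lact = lact P\<rparr>"
  let ?e = "\<lambda>t k. if k = t then 1 else 0 :: 'r"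
  have P': "graded_left_module R ?P" using P unfolding graded_left_module_def by simp
  have F: "graded_left_module R ?F" by (rule free_graded_left_module[OF R])
  note GF = graded_left_moduleD[OF F]
  define eps where "eps = free_map ?P (\<lambda>t. t)"
  have eps: "left_hom R ?F ?P eps"
    unfolding eps_def by (rule free_map_hom[OF R P']) (use deg in simp)
  have e: "?e t \<in> carr (gr ?F)" if "t \<in> T" for t
    by (rule in_carr[of _ _ "deg t"])
      (use that one graded_group_zero[OF G] in \<open>auto simp: free_gmod_def\<close>)
  \<comment> \<open>The zero ring needs its own case: there \<open>?e t\<close> has empty support,
    but \<open>t\<close> is 0 too, because 1 = 0 acts as the identity.\<close>
  have eps_e: "eps (?e t) = t" if "t \<in> T" for t
  proof (cases "(1::'r) = 0")
    case True
    then have "t = 0" using lact_one[OF P TP[OF that]] lact_zero_left[OF P TP[OF that]] by simp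
    then show ?thesis using True by (simp add: eps_def free_map_def)
  next
    case False
    then have "{k. ?e t k \<noteq> 0} = {t}" by auto
    then show ?thesis using lact_one[OF P TP[OF that]] by (simp add: eps_def free_map_def)
  qed
  have surj: "eps ` carr (gr ?F) = carr (gr ?P)"
  proof safe
    fix x assume "x \<in> carr (gr ?F)"
    then show "eps x \<in> carr (gr ?P)" by (rule left_hom_carr[OF eps GF graded_left_moduleD[OF P']])
  next
    fix x assume "x \<in> carr (gr ?P)"
    then obtain c where c: "\<And>t. t \<in> T \<Longrightarrow> c t \<in> carr R" "x = (\<Sum>t\<in>T. lact P (c t) t)"
      using gen by auto
    have "eps (\<Sum>t\<in>T. lact ?F (c t) (?e t)) = (\<Sum>t\<in>T. eps (lact ?F (c t) (?e t)))"
      by (rule left_hom_sum[OF eps GF]) (use c e lact_carr[OF G F] in blast)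
    also have "\<dots> = (\<Sum>t\<in>T. lact P (c t) t)"
    proof (rule sum.cong[OF refl])
      fix t assume t: "t \<in> T"
      have "eps (lact ?F (c t) (?e t)) = lact ?P (c t) (eps (?e t))"
        using eps c(1)[OF t] e[OF t] unfolding left_hom_def by blast
      then show "eps (lact ?F (c t) (?e t)) = lact P (c t) t" using eps_e[OF t] by simp
    qed
    finally have "x = eps (\<Sum>t\<in>T. lact ?F (c t) (?e t))" using c(2) by simp
    moreover have "(\<Sum>t\<in>T. lact ?F (c t) (?e t)) \<in> carr (gr ?F)"
      by (rule carr_sum[OF GF]) (use c e lact_carr[OF G F] in blast)
    ultimately show "x \<in> eps ` carr (gr ?F)" by blast
  qed
  have "left_hom R P ?P (\<lambda>x. x)" unfolding left_hom_def by simp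
  \<comment> \<open>Lifting the identity of \<open>P\<close> through the cover \<open>eps\<close>
    gives the section \<open>s\<close>.\<close>
  then obtain s where s: "left_hom R P ?F s" "\<And>x. x \<in> carr (gr P) \<Longrightarrow> eps (s x) = x"
    using proj F P' eps surj unfolding projective_def lifts_through_def by meson
  obtain h where h: "bij_betw h {..<card T} T"
    using ex_bij_betw_nat_finite[OF T(1)] by (auto simp: lessThan_atLeast0)
  then have hT: "h i \<in> T" if "i < card T" for i using that unfolding bij_betw_def by auto
  have "dual_basis R P (card T) h (\<lambda>i. deg (h i)) (\<lambda>i x. s x (h i))"
    unfolding dual_basis_def
  proof (intro conjI allI impI ballI)
    fix i assume i: "i < card T"
    show "h i \<in> gr P (deg (h i))" using deg hT[OF i] by blast
    show "s (x + y) (h i) = s x (h i) + s y (h i)"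
      if "x \<in> carr (gr P)" "y \<in> carr (gr P)" for x y
      using s(1) that unfolding left_hom_def by simp
    show "s x (h i) \<in> R (e - deg (h i))" if "x \<in> gr P e" for e x
    proof -
      have "s x \<in> gr ?F e" using s(1) that unfolding left_hom_def by blast
      then show ?thesis by (simp add: free_gmod_def)
    qed
    show "s (lact P r x) (h i) = r * s x (h i)" if "r \<in> carr R" "x \<in> carr (gr P)" for r x
      using s(1) that unfolding left_hom_def by (simp add: free_gmod_def)
  next
    fix x assume x: "x \<in> carr (gr P)"
    have "s x \<in> carr (gr ?F)"
      by (rule left_hom_carr[OF s(1) graded_left_moduleD[OF P] GF x])
    note fs = free_carr[OF G this]
    have "x = (\<Sum>t | s x t \<noteq> 0. lact P (s x t) t)"
      using s(2)[OF x] by (simp add: eps_def free_map_def)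
    also have "\<dots> = (\<Sum>t\<in>T. lact P (s x t) t)"
      by (rule sum.mono_neutral_left) (use fs T TP lact_zero_left[OF P] in auto)
    also have "\<dots> = (\<Sum>i<card T. lact P (s x (h i)) (h i))"
      by (rule sum.reindex_bij_betw[OF h, symmetric])
    finally show "x = (\<Sum>i<card T. lact P (s x (h i)) (h i))" .
  qed
  then show ?thesis by blast
qed

lemma dual_basis_finitely_generated:
  fixes R :: "'l::ab_group_add \<times> bit \<Rightarrow> 'r::{ring, monoid_mult} set"
    and P :: "('l, 'r, 'm::ab_group_add, 'z) gmod_scheme"
  assumes R: "graded_superring R" and P: "graded_left_module R P" and db: "dual_basis R P n m d c"
  shows "finitely_generated R P"
proof -
  have G: "graded_group R" using R unfolding graded_superring_def by blast
  have m: "m i \<in> carr (gr P)" if "i < n" for i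
    using db that unfolding dual_basis_def by (auto intro: in_carr)
  have c: "c i x \<in> carr R" if i: "i < n" and x: "x \<in> carr (gr P)" for i x
    using graded_left_moduleD[OF P] x
  proof (induction rule: carr_induct)
    case (hom e x)
    then have "c i x \<in> R (e - d i)" using db i unfolding dual_basis_def by blast
    then show ?case by (rule in_carr)
  next
    case (add x y)
    then have "c i (x + y) = c i x + c i y" using db i unfolding dual_basis_def by blast
    then show ?case using add carr_add[OF G] by simp
  qed
  have rsum: "lact P (\<Sum>j\<in>J. z j) t = (\<Sum>j\<in>J. lact P (z j) t)"
    if "t \<in> carr (gr P)" "\<And>j. j \<in> J \<Longrightarrow> z j \<in> carr R" for t J and z :: "nat \<Rightarrow> 'r"
    using that
    by (induction J rule: infinite_finite_induct)
      (auto simp: lact_zero_left[OF P] lact_add_left[OF P] carr_sum[OF G])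
  show ?thesis
    unfolding finitely_generated_def
  proof (intro exI[of _ "m ` {..<n}"] conjI ballI)
    fix x assume x: "x \<in> carr (gr P)"
    let ?b = "\<lambda>s. \<Sum>i | i \<in> {..<n} \<and> m i = s. c i x"
    have "x = (\<Sum>i<n. lact P (c i x) (m i))" using db x unfolding dual_basis_def by blast
    also have "\<dots> = (\<Sum>s\<in>m ` {..<n}. \<Sum>i | i \<in> {..<n} \<and> m i = s. lact P (c i x) (m i))"
      by (rule sum.group[symmetric]) auto
    also have "\<dots> = (\<Sum>s\<in>m ` {..<n}. lact P (?b s) s)"
      using m c[OF _ x] by (intro sum.cong refl) (subst rsum, auto)
    finally show "\<exists>b. (\<forall>s\<in>m ` {..<n}. b s \<in> carr R) \<and> x = (\<Sum>s\<in>m ` {..<n}. lact P (b s) s)"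
      using c[OF _ x] by (intro exI[of _ ?b] conjI ballI carr_sum[OF G]) auto
  qed (use m in auto)
qed

text \<open>The values \<open>f (m i)\<close> have homogeneous preimages \<open>k i\<close>, and
  sending \<open>x\<close> to the combination of the \<open>k i\<close> with coefficients
  \<open>c i x\<close> is a lift. Homogeneity of the \<open>k i\<close> makes it preserve
  degrees.\<close>

lemma dual_basis_projective:
  fixes P :: "('l::ab_group_add, 'r::{ring, monoid_mult}, 'm::ab_group_add, 'z) gmod_scheme"
  assumes R: "graded_superring R" and P: "graded_left_module R P" and db: "dual_basis R P n m d c"
  shows "projective R P"
  unfolding projective_def lifts_through_def
proof (intro allI impI)
  fix M :: "('l, 'r, 'm \<Rightarrow> 'r) gmod" and N :: "('l, 'r, 'm) gmod" and g f
  assume M: "graded_left_module R M" and N: "graded_left_module R N"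
    and gf: "left_hom R M N g \<and> g ` carr (gr M) = carr (gr N) \<and> left_hom R P N f"
  have G: "graded_group R" using R unfolding graded_superring_def by blast
  note GM = graded_left_moduleD[OF M] and GN = graded_left_moduleD[OF N]
    and GP = graded_left_moduleD[OF P]
  have m: "m i \<in> gr P (d i)" if "i < n" for i using db that unfolding dual_basis_def by blast
  have cadd: "c i (x + y) = c i x + c i y" if "i < n" "x \<in> carr (gr P)" "y \<in> carr (gr P)" for i x y
    using db that unfolding dual_basis_def by blast
  have cdeg: "c i x \<in> R (e - d i)" if "i < n" "x \<in> gr P e" for i e x
    using db that unfolding dual_basis_def by blast
  have clin: "c i (lact P r x) = r * c i x" if "i < n" "r \<in> carr R" "x \<in> carr (gr P)" for i r x
    using db that unfolding dual_basis_def by blast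
  have c: "c i x \<in> carr R" if i: "i < n" and x: "x \<in> carr (gr P)" for i x
    using GP x
  proof (induction rule: carr_induct)
    case (hom e x)
    then show ?case using cdeg[OF i hom] by (auto intro: in_carr)
  next
    case (add x y)
    then show ?case using cadd[OF i] carr_add[OF G] by simp
  qed
  have "\<exists>k. k \<in> gr M (d i) \<and> g k = f (m i)" if "i < n" for i
  proof -
    have "f (m i) \<in> gr N (d i)" using gf m[OF that] unfolding left_hom_def by blast
    then have "\<exists>k\<in>gr M (d i). g k = f (m i)"
      by (rule homogeneous_preimage[OF GM GN conjunct1[OF gf] conjunct1[OF conjunct2[OF gf]]])
    then show ?thesis by blast
  qed
  then obtain k where k: "\<And>i. i < n \<Longrightarrow> k i \<in> gr M (d i)" "\<And>i. i < n \<Longrightarrow> g (k i) = f (m i)"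
    by metis
  have kM: "k i \<in> carr (gr M)" if "i < n" for i using k(1)[OF that] by (rule in_carr)
  have mP: "m i \<in> carr (gr P)" if "i < n" for i using m[OF that] by (rule in_carr)
  have rsum: "lact M r (\<Sum>i\<in>J. z i) = (\<Sum>i\<in>J. lact M r (z i))"
    if "r \<in> carr R" "\<And>i. i \<in> J \<Longrightarrow> z i \<in> carr (gr M)" for r J and z :: "nat \<Rightarrow> _"
    using that
    by (induction J rule: infinite_finite_induct)
      (auto simp: lact_zero_right[OF M] lact_add_right[OF M] carr_sum[OF GM])
  let ?h = "\<lambda>x. \<Sum>i<n. lact M (c i x) (k i)"
  have "left_hom R P M ?h"
    unfolding left_hom_def
  proof (intro conjI allI ballI)
    show "?h (x + y) = ?h x + ?h y" if "x \<in> carr (gr P)" "y \<in> carr (gr P)" for x y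
      unfolding sum.distrib[symmetric]
      by (rule sum.cong) (use that cadd c kM lact_add_left[OF M] in auto)
    show "?h ` gr P e \<subseteq> gr M e" for e
    proof safe
      fix x assume x: "x \<in> gr P e"
      have "lact M (c i x) (k i) \<in> gr M (e - d i + d i)" if "i < n" for i
        by (rule lact_graded[OF M]) (use that x cdeg k in auto)
      then show "?h x \<in> gr M e" by (intro graded_group_sum[OF GM]) simp
    qed
    show "?h (lact P r x) = lact M r (?h x)" if "r \<in> carr R" "x \<in> carr (gr P)" for r x
      by (subst rsum) (use that c kM clin lact_mult[OF M] lact_carr[OF G M] in auto)
  qed
  moreover have "g (?h x) = f x" if x: "x \<in> carr (gr P)" for x
  proof -
    have "g (?h x) = (\<Sum>i<n. g (lact M (c i x) (k i)))"
      by (rule left_hom_sum[OF conjunct1[OF gf] GM]) (use c x kM lact_carr[OF G M] in auto)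
    also have "\<dots> = (\<Sum>i<n. f (lact P (c i x) (m i)))"
    proof (rule sum.cong[OF refl])
      fix i assume "i \<in> {..<n}"
      then have i: "i < n" by simp
      have "g (lact M (c i x) (k i)) = lact N (c i x) (g (k i))"
        using conjunct1[OF gf] c[OF i x] kM[OF i] by (simp add: left_hom_def)
      moreover have "f (lact P (c i x) (m i)) = lact N (c i x) (f (m i))"
        using conjunct2[OF conjunct2[OF gf]] c[OF i x] mP[OF i] by (simp add: left_hom_def)
      ultimately show "g (lact M (c i x) (k i)) = f (lact P (c i x) (m i))" using k(2)[OF i] by simp
    qed
    also have "\<dots> = f (\<Sum>i<n. lact P (c i x) (m i))"
      by (rule left_hom_sum[OF conjunct2[OF conjunct2[OF gf]] GP, symmetric]) (use c x mP lact_carr[OF G P] in auto)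
    also have "(\<Sum>i<n. lact P (c i x) (m i)) = x" using db x unfolding dual_basis_def by metis
    finally show ?thesis .
  qed
  ultimately show "\<exists>h. left_hom R P M h \<and> (\<forall>x\<in>carr (gr P). g (h x) = f x)" by blast
qed

section \<open>Twisted ring extensions\<close>

text \<open>The ring is identified with its ambient type, so \<open>inv \<alpha>\<close> is the true
  inverse and homomorphisms out of the ring are equal exactly when they are equal as functions. The
  subring stays a subset.\<close>

locale twisted_extension =
  fixes GA :: "'l::ab_group_add \<times> bit \<Rightarrow> 'a::{ring, monoid_mult} set"
    and B :: "'a set" and \<alpha> \<beta> :: "'a \<Rightarrow> 'a" and lam :: 'l and \<pi> :: bit
  assumes superring: "graded_superring GA" and carr_UNIV [simp]: "carr GA = UNIV"
    and subring: "graded_subring GA B"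
    and aut_\<alpha>: "graded_automorphism GA \<alpha>"
    and aut_\<beta>: "graded_automorphism (restrict_grading GA B) \<beta>"
begin

abbreviation GB where "GB \<equiv> restrict_grading GA B"
abbreviation D where "D \<equiv> (lam, \<pi>)"
abbreviation M where "M \<equiv> twisted GA \<beta> \<alpha>"
abbreviation N where "N \<equiv> shift GB lam \<pi> (regular GB)"
abbreviation Hom where "Hom \<equiv> HOM_deg GB M N"
abbreviation H where "H \<equiv> HOM_L GB GA GB M N"

lemma graded_GA: "graded_group GA"
  using superring unfolding graded_superring_def by blast

lemma GA_mult: "x \<in> GA d \<Longrightarrow> y \<in> GA e \<Longrightarrow> x * y \<in> GA (d + e)"
  using superring unfolding graded_superring_def by blast

lemma GA_one: "1 \<in> GA 0"
  using superring unfolding graded_superring_def by blast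

lemma carr_GB [simp]: "carr GB = B"
  using subring unfolding graded_subring_def by blast

lemma GB_iff: "x \<in> GB d \<longleftrightarrow> x \<in> GA d \<and> x \<in> B"
  by (simp add: restrict_grading_def)

lemma B_diff: "x \<in> B \<Longrightarrow> y \<in> B \<Longrightarrow> x - y \<in> B"
  and B_mult: "x \<in> B \<Longrightarrow> y \<in> B \<Longrightarrow> x * y \<in> B"
  and B_one: "1 \<in> B"
  using subring unfolding graded_subring_def by blast+

lemma B_zero: "0 \<in> B"
  using carr_zero[of GB] by simp

lemma graded_GB: "graded_group GB"
  using graded_GA unfolding graded_group_def GB_iff
  by (auto simp: GB_iff intro: B_diff B_zero)

lemma B_add: "x \<in> B \<Longrightarrow> y \<in> B \<Longrightarrow> x + y \<in> B"
  using carr_add[OF graded_GB] by simp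

lemma superring_GB: "graded_superring GB"
  using graded_GB GA_one GA_mult unfolding graded_superring_def GB_iff
  by (auto simp: GB_iff B_one B_mult simp del: split_paired_All add_Pair)

lemma GA_induct [case_names hom add]:
  assumes "\<And>d x. x \<in> GA d \<Longrightarrow> P x" and "\<And>x y. P x \<Longrightarrow> P y \<Longrightarrow> P (x + y)"
  shows "P x"
  by (rule carr_induct[OF graded_GA, of x]) (use assms in auto)

lemma B_induct [consumes 1, case_names hom add]:
  assumes "x \<in> B" and "\<And>d x. x \<in> GB d \<Longrightarrow> P x"
    and "\<And>x y. x \<in> B \<Longrightarrow> y \<in> B \<Longrightarrow> P x \<Longrightarrow> P y \<Longrightarrow> P (x + y)"
  shows "P x"
  by (rule carr_induct[OF graded_GB, of x]) (use assms in auto)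

text \<open>The main extension principle: signed identities are checked on homogeneous arguments,
  where the exponents are constants.\<close>

lemma fun_eq_homogeneous:
  assumes "\<And>x y. f (x + y) = f x + f y" "\<And>x y. g (x + y) = g x + g y"
    and "\<And>d x. x \<in> GA d \<Longrightarrow> f x = g x"
  shows "f = g"
proof
  show "f x = g x" for x by (induction x rule: GA_induct) (simp_all add: assms)
qed

section \<open>The automorphisms and their graded inverses\<close>

lemma \<alpha>_add: "\<alpha> (x + y) = \<alpha> x + \<alpha> y" and \<alpha>_mult: "\<alpha> (x * y) = \<alpha> x * \<alpha> y"
  and \<alpha>_bij: "bij \<alpha>"
  using aut_\<alpha> by (simp_all add: graded_automorphism_def)

lemma \<alpha>_GA: "x \<in> GA d \<Longrightarrow> \<alpha> x \<in> GA d"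
  using aut_\<alpha> unfolding graded_automorphism_def by blast

lemma \<alpha>_inv [simp]: "\<alpha> (inv \<alpha> x) = x" and inv_\<alpha> [simp]: "inv \<alpha> (\<alpha> x) = x"
  using \<alpha>_bij by (simp_all add: bij_is_surj surj_f_inv_f bij_is_inj)

lemma inv_\<alpha>_GA: "x \<in> GA d \<Longrightarrow> inv \<alpha> x \<in> GA d"
  using graded_automorphism_preimage[OF graded_GA aut_\<alpha>, of x d] by auto

lemma \<alpha>_sum: "\<alpha> (\<Sum>i\<in>I. x i) = (\<Sum>i\<in>I. \<alpha> (x i))"
  by (rule sum_additive) (rule \<alpha>_add)

lemma \<alpha>_psign: "\<alpha> (psign p x) = psign p (\<alpha> x)"
  by (rule psign_additive) (rule \<alpha>_add)

lemma \<beta>_add: "x \<in> B \<Longrightarrow> y \<in> B \<Longrightarrow> \<beta> (x + y) = \<beta> x + \<beta> y"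
  and \<beta>_mult: "x \<in> B \<Longrightarrow> y \<in> B \<Longrightarrow> \<beta> (x * y) = \<beta> x * \<beta> y"
  and \<beta>_bij: "bij_betw \<beta> B B"
  using aut_\<beta> by (simp_all add: graded_automorphism_def)

lemma \<beta>_GB: "x \<in> GB d \<Longrightarrow> \<beta> x \<in> GB d"
  using aut_\<beta> unfolding graded_automorphism_def by blast

text \<open>The inverse is taken relative to \<open>B\<close>, since nothing is known about \<beta>
  outside \<open>B\<close>.\<close>

definition \<beta>' where "\<beta>' = inv_into B \<beta>"

lemma \<beta>'_B: "x \<in> B \<Longrightarrow> \<beta>' x \<in> B"
  and \<beta>_\<beta>': "x \<in> B \<Longrightarrow> \<beta> (\<beta>' x) = x" and \<beta>'_\<beta>: "x \<in> B \<Longrightarrow> \<beta>' (\<beta> x) = x"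
  using \<beta>_bij unfolding \<beta>'_def
  by (auto simp: bij_betw_def inv_into_into f_inv_into_f inv_into_f_f)

lemma \<beta>'_GB: "x \<in> GB d \<Longrightarrow> \<beta>' x \<in> GB d"
  using graded_automorphism_preimage[OF graded_GB aut_\<beta>, of x d] \<beta>'_\<beta>
  by (auto simp: GB_iff)

lemma \<beta>'_add: "x \<in> B \<Longrightarrow> y \<in> B \<Longrightarrow> \<beta>' (x + y) = \<beta>' x + \<beta>' y"
  using \<beta>_add[of "\<beta>' x" "\<beta>' y"] \<beta>'_\<beta>[of "\<beta>' x + \<beta>' y"] by (simp add: \<beta>'_B \<beta>_\<beta>' B_add)

lemma \<beta>'_mult: "x \<in> B \<Longrightarrow> y \<in> B \<Longrightarrow> \<beta>' (x * y) = \<beta>' x * \<beta>' y"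
  using \<beta>_mult[of "\<beta>' x" "\<beta>' y"] \<beta>'_\<beta>[of "\<beta>' x * \<beta>' y"] by (simp add: \<beta>'_B \<beta>_\<beta>' B_mult)

lemma \<beta>_zero: "\<beta> 0 = 0"
  using \<beta>_add[of 0 0] B_zero by simp

lemma \<beta>_psign: "x \<in> B \<Longrightarrow> \<beta> (psign p x) = psign p (\<beta> x)"
  using \<beta>_add[of x "- x"] B_diff[of 0 x] B_zero \<beta>_zero
  by (simp add: psign_def eq_neg_iff_add_eq_0 add.commute)

section \<open>The twisted source and the shifted target\<close>

lemma gr_regular [simp]: "gr (regular G) = G" and lact_regular [simp]: "lact (regular G) = (*)"
  and ract_regular [simp]: "ract (regular G) = (*)"
  by (simp_all add: regular_def)

lemma regular_module: "graded_left_module GB (regular GA)"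
  using graded_GA GA_mult
  by (auto simp: graded_left_module_def regular_def GB_iff algebra_simps)

lemma gr_M [simp]: "gr M = GA" and lact_M [simp]: "lact M b x = \<beta> b * x"
  and ract_M [simp]: "ract M x a = x * \<alpha> a"
  by (simp_all add: twisted_def)

text \<open>Parities form a group of exponent 2, so the sum of parities in the definition of the
  shift is a difference, and both parts of the degree are covered by subtracting
  \<open>D\<close>.\<close>

lemma gr_N [simp]: "gr N e = GB (e - D)" and ract_N [simp]: "ract N x b = x * b"
  by (cases e; simp add: shift_def regular_def)+

lemma lact_N: "r \<in> GB e \<Longrightarrow> lact N r x = psign (\<pi> * snd e) (r * x)"
  unfolding shift_def regular_def
  by (simp only: gmod.simps gbimod.simps)
     (rule sum_par_hom[OF graded_GB, where f = "\<lambda>p z. psign (\<pi> * p) (z * x)"], simp_all)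

lemma lact_N_add: "r \<in> B \<Longrightarrow> s \<in> B \<Longrightarrow> lact N (r + s) x = lact N r x + lact N s x"
  by (simp add: shift_def regular_def par_add[OF graded_GB] psign_add algebra_simps)

section \<open>The bimodule of homomorphisms\<close>

text \<open>The sign of a homomorphism of degree \<open>d\<close> and the sign in the left action on
  the shifted target combine, which is why \<pi> is added to the parity of \<open>d\<close>. From
  here on the target is the unshifted subring.\<close>

lemma Hom_iff: "f \<in> Hom d \<longleftrightarrow>
  (\<forall>x y. f (x + y) = f x + f y) \<and> (\<forall>e. \<forall>x\<in>GA e. f x \<in> GB (e + d - D)) \<and>
  (\<forall>e. \<forall>r\<in>GB e. \<forall>x. f (\<beta> r * x) = psign ((snd d + \<pi>) * snd e) (r * f x))"
  unfolding HOM_deg_def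
  by (simp add: lact_N psign_psign distrib_right cong: ball_cong)

lemma Hom_add: "f \<in> Hom d \<Longrightarrow> f (x + y) = f x + f y"
  and Hom_GB: "f \<in> Hom d \<Longrightarrow> x \<in> GA e \<Longrightarrow> f x \<in> GB (e + d - D)"
  and Hom_lin: "f \<in> Hom d \<Longrightarrow> r \<in> GB e \<Longrightarrow> f (\<beta> r * x) = psign ((snd d + \<pi>) * snd e) (r * f x)"
  unfolding Hom_iff by blast+

text \<open>Independence is tested by evaluating at a homogeneous \<open>x\<close>: maps of distinct
  degrees take values in distinct degrees.\<close>

lemma graded_Hom: "graded_group Hom"
  unfolding graded_group_def
proof (intro conjI allI impI ballI)
  show "0 \<in> Hom d" for d
    by (simp add: Hom_iff graded_group_zero[OF graded_GB])
  show "f - g \<in> Hom d" if "f \<in> Hom d" "g \<in> Hom d" for d f g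
    using that unfolding Hom_iff by (auto simp: graded_group_diff[OF graded_GB] psign_diff algebra_simps)
next
  fix I and f :: "'l \<times> bit \<Rightarrow> 'a \<Rightarrow> 'a" and d
  assume I: "finite I" "\<forall>d\<in>I. f d \<in> Hom d" "(\<Sum>d\<in>I. f d) = 0" and d: "d \<in> I"
  have f: "f d \<in> Hom d" if "d \<in> I" for d using I that by blast
  show "f d = 0"
  proof (rule fun_eq_homogeneous)
    fix e x assume x: "x \<in> GA e"
    \<comment> \<open>The summands are reindexed by the degree \<open>k\<close> of their value,
      inverting the passage from \<open>d\<close> to \<open>e + d - D\<close>.\<close>
    let ?g = "\<lambda>k. f (k + D - e) x"
    have "(\<Sum>k\<in>(\<lambda>d. e + d - D) ` I. ?g k) = (\<Sum>d\<in>I. f d x)"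
      by (subst sum.reindex) (auto intro: inj_onI simp: algebra_simps simp del: add_Pair diff_Pair)
    also have "\<dots> = 0" using I(3) sum_fun_apply[of f I x] by simp
    finally have 0: "(\<Sum>k\<in>(\<lambda>d. e + d - D) ` I. ?g k) = 0" .
    have g: "?g k \<in> GB k" if "k \<in> (\<lambda>d. e + d - D) ` I" for k
      using that Hom_GB[OF f x] by (auto simp: algebra_simps simp del: add_Pair diff_Pair split_paired_All)
    have "?g (e + d - D) = 0"
      by (rule graded_group_indep[OF graded_GB _ g 0]) (use I(1) d in auto)
    then show "f d x = 0 x" by (simp add: algebra_simps del: add_Pair diff_Pair)
  qed (use f[OF d] Hom_add in auto)
qed

lemma carr_Hom_add: "f \<in> carr Hom \<Longrightarrow> f (x + y) = f x + f y"
  using graded_Hom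
  by (induction f rule: carr_induct[consumes 2]) (auto simp: Hom_add algebra_simps)

lemma carr_Hom_zero: "f \<in> carr Hom \<Longrightarrow> f 0 = 0"
  using carr_Hom_add[of f 0 0] by simp

section \<open>The two actions on homomorphisms\<close>

lemma gr_H [simp]: "gr H = Hom"
  by (simp add: HOM_L_def)

lemma lact_H_eq: "lact H s f x =
  (\<Sum>p\<in>{0, 1}. \<Sum>q\<in>{0, 1}. \<Sum>k\<in>{0, 1}. psign (p * q + p * k) (par Hom q f (par GA k x * \<alpha> (par GA p s))))"
  by (simp only: HOM_L_def gmod.simps gr_M carr_UNIV UNIV_I if_True ract_M)

lemma ract_H_eq: "ract H f t x =
  (\<Sum>p\<in>{0, 1}. \<Sum>k\<in>{0, 1}. psign (p * k) (f (par GA k x) * par GB p t))"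
  by (simp only: HOM_L_def gbimod.simps gr_M carr_UNIV UNIV_I if_True ract_N)

lemma lact_H:
  assumes s: "s \<in> GA d" and f: "f \<in> Hom e" and x: "x \<in> GA k"
  shows "lact H s f x = psign (snd d * snd e + snd d * snd k) (f (x * \<alpha> s))"
proof -
  have fc: "f \<in> carr Hom" using f by (rule in_carr)
  have \<alpha>0: "\<alpha> 0 = 0" using \<alpha>_add[of 0 0] by simp
  have "lact H s f x = (\<Sum>p\<in>{0, 1}. \<Sum>q\<in>{0, 1}.
      psign (p * q + p * snd k) (par Hom q f (x * \<alpha> (par GA p s))))"
    unfolding lact_H_eq
    by (intro sum.cong refl, rule sum_par_hom[OF graded_GA x])
      (simp add: carr_Hom_zero par_carr[OF graded_Hom fc])
  also have "\<dots> = (\<Sum>p\<in>{0, 1}. psign (p * snd e + p * snd k) (f (x * \<alpha> (par GA p s))))"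
    by (intro sum.cong refl,
        rule sum_par_hom[OF graded_Hom f, where f = "\<lambda>q g. psign (_ * q + _ * snd k) (g (x * \<alpha> (par GA _ s)))"])
      simp
  also have "\<dots> = psign (snd d * snd e + snd d * snd k) (f (x * \<alpha> s))"
    by (rule sum_par_hom[OF graded_GA s]) (simp add: \<alpha>0 carr_Hom_zero fc)
  finally show ?thesis .
qed

lemma lact_H_add_left: "f \<in> carr Hom \<Longrightarrow> lact H (s + t) f = lact H s f + lact H t f"
  and lact_H_add_right: "f \<in> carr Hom \<Longrightarrow> g \<in> carr Hom \<Longrightarrow> lact H s (f + g) = lact H s f + lact H s g"
  and lact_H_add_arg: "f \<in> carr Hom \<Longrightarrow> lact H s f (x + y) = lact H s f x + lact H s f y"
  by (simp_all only: fun_eq_iff plus_fun_apply lact_H_eq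
      par_add[OF graded_GA] par_add[OF graded_Hom] carr_UNIV UNIV_I \<alpha>_add distrib_left
      distrib_right carr_Hom_add par_carr[OF graded_Hom] psign_add sum.distrib simp_thms)

lemma ract_H:
  assumes f: "\<And>x y. f (x + y) = f x + f y" and t: "t \<in> GB d" and x: "x \<in> GA k"
  shows "ract H f t x = psign (snd d * snd k) (f x * t)"
proof -
  have f0: "f 0 = 0" using f[of 0 0] by simp
  have "ract H f t x = (\<Sum>p\<in>{0, 1}. psign (p * snd k) (f x * par GB p t))"
    unfolding ract_H_eq
    by (intro sum.cong refl, rule sum_par_hom[OF graded_GA x]) (simp add: f0)
  also have "\<dots> = psign (snd d * snd k) (f x * t)"
    by (rule sum_par_hom[OF graded_GB t]) simp
  finally show ?thesis .
qed

lemma ract_H_add_left: "ract H (f + g) t = ract H f t + ract H g t"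
  and ract_H_add_right: "t \<in> B \<Longrightarrow> u \<in> B \<Longrightarrow> ract H f (t + u) = ract H f t + ract H f u"
  and ract_H_add_arg: "f \<in> carr Hom \<Longrightarrow> ract H f t (x + y) = ract H f t x + ract H f t y"
  by (simp_all only: fun_eq_iff plus_fun_apply ract_H_eq
      par_add[OF graded_GA] par_add[OF graded_GB] carr_UNIV carr_GB UNIV_I distrib_left
      distrib_right carr_Hom_add psign_add sum.distrib simp_thms)

text \<open>Passing from \<open>x\<close> to \<open>\<beta> r * x\<close> changes the
  argument-dependent sign of the action by the product of the parities of \<open>s\<close> and
  \<open>r\<close>. This is precisely what raises the parity of the homomorphism by that of
  \<open>s\<close>.\<close>

lemma lact_H_Hom:
  assumes s: "s \<in> GA d" and f: "f \<in> Hom e"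
  shows "lact H s f \<in> Hom (d + e)"
  unfolding Hom_iff
proof (intro conjI allI ballI)
  have fc: "f \<in> carr Hom" using f by (rule in_carr)
  note add = lact_H_add_arg[OF fc]
  show "lact H s f (x + y) = lact H s f x + lact H s f y" for x y by (rule add)
  show "lact H s f x \<in> GB (k + (d + e) - D)" if x: "x \<in> GA k" for k x
    unfolding lact_H[OF s f x]
    using Hom_GB[OF f GA_mult[OF x \<alpha>_GA[OF s]]]
    by (intro psign_in[OF graded_GB]) (simp add: add.assoc del: add_Pair diff_Pair)
  show "lact H s f (\<beta> r * x) = psign ((snd (d + e) + \<pi>) * snd k) (r * lact H s f x)"
    if r: "r \<in> GB k" for k r x
  proof (induction x rule: GA_induct)
    case (hom l x)
    have \<beta>r: "\<beta> r \<in> GA k" using \<beta>_GB[OF r] by (simp add: GB_iff)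
    show ?case
      unfolding lact_H[OF s f hom] lact_H[OF s f GA_mult[OF \<beta>r hom]]
      by (simp add: mult.assoc Hom_lin[OF f r] psign_psign psign_mult_right)
        (simp add: algebra_simps)
  next
    case (add x y)
    then show ?case by (simp add: distrib_left lact_H_add_arg[OF fc] psign_add)
  qed
qed

text \<open>The product of the parities of \<open>s\<close> and \<open>t\<close> occurs twice and
  cancels: once because \<open>t\<close> changes the parity of \<open>f\<close>, once because
  \<open>\<alpha> s\<close> changes the parity of the argument.\<close>

lemma lact_H_mult:
  assumes f: "f \<in> carr Hom"
  shows "lact H (s * t) f = lact H s (lact H t f)"
proof -
  \<comment> \<open>The action is known to be additive in the homomorphism only within
    \<open>carr Hom\<close>, so the inner action must stay there.\<close>
  have closed: "lact H t f \<in> carr Hom" if f: "f \<in> carr Hom" for t f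
    using graded_Hom f
  proof (induction rule: carr_induct)
    case (hom e f)
    then have fc: "f \<in> carr Hom" by (auto intro: in_carr)
    show ?case
    proof (induction t rule: GA_induct)
      case (hom d t)
      show ?case using lact_H_Hom[OF hom \<open>f \<in> Hom e\<close>] by (rule in_carr)
    next
      case (add x y)
      then show ?case by (simp only: lact_H_add_left[OF fc] carr_add[OF graded_Hom])
    qed
  next
    case (add f g)
    then show ?case by (simp only: lact_H_add_right carr_add[OF graded_Hom])
  qed
  show ?thesis
    using graded_Hom f
  proof (induction arbitrary: s t rule: carr_induct)
    case (hom e f)
    then have fc: "f \<in> carr Hom" by (auto intro: in_carr)
    show ?case
    proof (induction s rule: GA_induct)
      case (hom d s)
      note s = hom
      show ?case
      proof (induction t rule: GA_induct)
        case (hom k t)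
        show ?case
        proof (rule fun_eq_homogeneous)
          fix l x assume x: "x \<in> GA l"
          have "lact H s (lact H t f) x =
              psign (snd d * snd (k + e) + snd d * snd l) (lact H t f (x * \<alpha> s))"
            by (rule lact_H[OF s lact_H_Hom[OF hom \<open>f \<in> Hom e\<close>] x])
          also have "lact H t f (x * \<alpha> s) = psign (snd k * snd e + snd k * snd (l + d)) (f (x * \<alpha> s * \<alpha> t))"
            by (rule lact_H[OF hom \<open>f \<in> Hom e\<close> GA_mult[OF x \<alpha>_GA[OF s]]])
          finally show "lact H (s * t) f x = lact H s (lact H t f) x"
            by (simp add: lact_H[OF GA_mult[OF s hom] \<open>f \<in> Hom e\<close> x] \<alpha>_mult psign_psign mult.assoc)
              (simp add: algebra_simps)
        qed (simp_all only: lact_H_add_arg fc closed)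
      next
        case (add x y)
        then show ?case by (simp only: distrib_left lact_H_add_left fc lact_H_add_right closed)
      qed
    next
      case (add x y)
      then show ?case by (simp only: distrib_right lact_H_add_left fc closed)
    qed
  next
    case (add f g)
    then show ?case by (simp only: lact_H_add_right closed)
  qed
qed

text \<open>In degree 0 the homomorphism itself contributes no sign, so strict linearity into the
  shifted module and signed linearity on homogeneous scalars agree. Additivity extends the latter to
  all of \<open>B\<close>.\<close>

lemma trace_iff:
  "bimod_hom GB GB M N tr \<longleftrightarrow> tr \<in> Hom 0 \<and> (\<forall>x. \<forall>b\<in>B. tr (x * \<alpha> b) = tr x * b)"
proof -
  have "(\<forall>r\<in>B. \<forall>x. tr (\<beta> r * x) = lact N r (tr x)) \<longleftrightarrow>
      (\<forall>e. \<forall>r\<in>GB e. \<forall>x. tr (\<beta> r * x) = psign (\<pi> * snd e) (r * tr x))" (is "?L \<longleftrightarrow> ?R")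
    if add: "\<And>x y. tr (x + y) = tr x + tr y"
  proof
    assume L: ?L
    show ?R
    proof (intro allI ballI)
      fix e r x assume r: "r \<in> GB e"
      then have "r \<in> B" by (simp add: GB_iff)
      then have "tr (\<beta> r * x) = lact N r (tr x)" using L by blast
      then show "tr (\<beta> r * x) = psign (\<pi> * snd e) (r * tr x)" by (simp only: lact_N[OF r])
    qed
  next
    assume R: ?R
    show ?L
    proof (intro ballI allI)
      fix r x assume "r \<in> B"
      then show "tr (\<beta> r * x) = lact N r (tr x)"
      proof (induction r rule: B_induct)
        case (hom d r)
        then show ?case using R by (simp only: lact_N)
      next
        case (add r s)
        then show ?case by (simp only: \<beta>_add lact_N_add distrib_right that)
      qed
    qed
  qed
  then show ?thesis
    unfolding bimod_hom_def left_hom_def Hom_iff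
    by (auto simp: image_subset_iff simp del: diff_Pair)
qed

section \<open>Traces and Frobenius extensions\<close>

lemma Hom_B:
  assumes "f \<in> Hom d"
  shows "f x \<in> B"
proof (induction x rule: GA_induct)
  case (hom e x)
  then show ?case using Hom_GB[OF assms hom] by (simp add: GB_iff)
next
  case (add x y)
  then show ?case using assms by (simp add: Hom_add B_add)
qed

text \<open>The computation shared by both directions. The exponent \<open>q\<close> is the parity
  by which \<open>g\<close> is linear: \<pi> when \<open>g\<close> is the trace of a right
  translate, and the parity of \<open>f\<close> plus \<pi> when \<open>g\<close> is a homomorphism
  \<open>f\<close>.\<close>

lemma expand_by_trace:
  assumes tr: "tr \<in> Hom 0"
    and y: "\<And>i. i < n \<Longrightarrow> y i \<in> GA (D - d i)"
    and expand: "\<And>e a. a \<in> GA e \<Longrightarrow>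
      a = psign (\<pi> * snd e) (\<Sum>i<n. psign (\<pi> * snd (d i)) (\<beta> (tr (a * y i)) * x i))"
    and g: "\<And>u v. g (u + v) = g u + g v"
    and g_lin: "\<And>e r u. r \<in> GB e \<Longrightarrow> g (\<beta> r * u) = psign (q * snd e) (r * g u)"
    and z: "z \<in> GA k"
  shows "g z = (\<Sum>i<n. psign ((q + \<pi>) * (snd k + snd (d i))) (tr (z * y i) * g (x i)))"
proof -
  have "g z = g (psign (\<pi> * snd k) (\<Sum>i<n. psign (\<pi> * snd (d i)) (\<beta> (tr (z * y i)) * x i)))"
    using expand[OF z] by simp
  also have "\<dots> = (\<Sum>i<n. psign (\<pi> * snd k) (psign (\<pi> * snd (d i)) (g (\<beta> (tr (z * y i)) * x i))))"
    by (simp only: psign_additive[of g, OF g] sum_additive[of g, OF g] psign_sum)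
  also have "\<dots> = (\<Sum>i<n. psign ((q + \<pi>) * (snd k + snd (d i))) (tr (z * y i) * g (x i)))"
  proof (rule sum.cong[OF refl])
    fix i assume "i \<in> {..<n}"
    then have "z * y i \<in> GA (k + (D - d i))" using GA_mult[OF z y] by simp
    \<comment> \<open>The \<open>D\<close> in the degree of \<open>y i\<close> cancels the degree of
      the trace, so the coefficient has the parity of \<open>z\<close> plus that of
      \<open>x i\<close>.\<close>
    from Hom_GB[OF tr this] have "tr (z * y i) \<in> GB (k - d i)"
      by (simp add: algebra_simps del: add_Pair diff_Pair)
    from g_lin[OF this]
    show "psign (\<pi> * snd k) (psign (\<pi> * snd (d i)) (g (\<beta> (tr (z * y i)) * x i))) =
        psign ((q + \<pi>) * (snd k + snd (d i))) (tr (z * y i) * g (x i))"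
      by (simp add: psign_psign) (simp add: algebra_simps)
  qed
  finally show ?thesis .
qed

text \<open>The image of 1 has degree 0, so of the two terms in the sign of the left action only the
  one involving the argument remains. For a scalar in \<open>B\<close> it equals the sign of the
  right action, and comparing the two leaves an unsigned right linearity.\<close>

lemma trace_of_frobenius:
  assumes \<Phi>: "bimod_hom GA GB (regular GA) H \<Phi>"
  shows "\<Phi> 1 \<in> Hom 0" and "b \<in> B \<Longrightarrow> \<Phi> 1 (x * \<alpha> b) = \<Phi> 1 x * b"
    and "a \<in> GA e \<Longrightarrow> x \<in> GA k \<Longrightarrow> \<Phi> a x = psign (snd e * snd k) (\<Phi> 1 (x * \<alpha> a))"
proof -
  show tr: "\<Phi> 1 \<in> Hom 0"
    using \<Phi> GA_one by (auto simp: bimod_hom_def left_hom_def image_subset_iff simp del: split_paired_All)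
  have "\<Phi> (a * 1) = lact H a (\<Phi> 1)" for a
    using \<Phi> by (simp only: bimod_hom_def left_hom_def carr_UNIV gr_regular lact_regular) blast
  then have \<Phi>_lact: "\<Phi> a = lact H a (\<Phi> 1)" for a by (metis mult_1_right)
  show eval: "\<Phi> a x = psign (snd e * snd k) (\<Phi> 1 (x * \<alpha> a))"
    if "a \<in> GA e" "x \<in> GA k" for a e x k
    using lact_H[OF that(1) tr that(2)] unfolding \<Phi>_lact[of a, symmetric] by simp
  have \<Phi>_ract: "\<Phi> b = ract H (\<Phi> 1) b" if "b \<in> B" for b
  proof -
    have "\<Phi> (1 * b) = ract H (\<Phi> 1) b"
      using \<Phi> that by (simp only: bimod_hom_def carr_UNIV carr_GB gr_regular ract_regular) blast
    then show ?thesis unfolding mult_1_left .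
  qed
  show "\<Phi> 1 (x * \<alpha> b) = \<Phi> 1 x * b" if "b \<in> B"
    using that
  proof (induction b rule: B_induct)
    case (hom d b)
    then have b: "b \<in> GA d" "b \<in> B" by (simp_all add: GB_iff)
    show ?case
    proof (induction x rule: GA_induct)
      case (hom k x)
      have "psign (snd d * snd k) (\<Phi> 1 (x * \<alpha> b)) = psign (snd d * snd k) (\<Phi> 1 x * b)"
        using eval[OF b(1) hom] ract_H[OF Hom_add[OF tr] \<open>b \<in> GB d\<close> hom] \<Phi>_ract[OF b(2)] by simp
      then show ?case by (simp only: psign_eq_iff)
    next
      case (add x y)
      then show ?case by (simp only: distrib_right Hom_add[OF tr])
    qed
  next
    case (add b c)
    then show ?case by (simp only: \<alpha>_add distrib_left Hom_add[OF tr])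
  qed
qed

text \<open>For the trace t, expanding t(z \<alpha>(a)) gives the sum of t(z y_i) t(x_i
  \<alpha>(a)). Right linearity absorbs the second factor into the argument as its image under
  \<alpha>, producing t(z \<alpha>(b)) with b the right side of the formula.\<close>

lemma trace_expansion_right:
  assumes \<Phi>: "bimod_hom GA GB (regular GA) H \<Phi>" and inj: "inj \<Phi>"
    and xy: "\<And>i. i < n \<Longrightarrow> x i \<in> GA (d i)" "\<And>i. i < n \<Longrightarrow> y i \<in> GA (D - d i)"
    and expand: "\<And>e a. a \<in> GA e \<Longrightarrow>
      a = psign (\<pi> * snd e) (\<Sum>i<n. psign (\<pi> * snd (d i)) (\<beta> (\<Phi> 1 (a * y i)) * x i))"
  shows "a = (\<Sum>i<n. inv \<alpha> (y i) * \<Phi> 1 (x i * \<alpha> a))"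
proof -
  note tr = trace_of_frobenius[OF \<Phi>]
  show ?thesis
  proof (induction a rule: GA_induct)
    case (hom e a)
    let ?b = "\<Sum>i<n. inv \<alpha> (y i) * \<Phi> 1 (x i * \<alpha> a)"
    have "inv \<alpha> (y i) * \<Phi> 1 (x i * \<alpha> a) \<in> GA e" if i: "i < n" for i
    proof -
      have "\<Phi> 1 (x i * \<alpha> a) \<in> GB (d i + e + 0 - D)"
        by (rule Hom_GB[OF tr(1) GA_mult[OF xy(1)[OF i] \<alpha>_GA[OF hom]]])
      then have "\<Phi> 1 (x i * \<alpha> a) \<in> GA (d i + e - D)"
        by (simp only: GB_iff add_0_right)
      from GA_mult[OF inv_\<alpha>_GA[OF xy(2)[OF i]] this]
      have "inv \<alpha> (y i) * \<Phi> 1 (x i * \<alpha> a) \<in> GA (D - d i + (d i + e - D))" .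
      then show ?thesis by (simp add: algebra_simps del: add_Pair diff_Pair)
    qed
    \<comment> \<open>The sign in evaluating \<Phi> depends on the degree of its argument, so both
      sides must be homogeneous of the same degree before their images are compared.\<close>
    then have b: "?b \<in> GA e" by (intro graded_group_sum[OF graded_GA]) simp
    have \<Phi>_Hom: "\<Phi> c \<in> Hom e" if "c \<in> GA e" for c
      using \<Phi> that
      by (auto simp: bimod_hom_def left_hom_def image_subset_iff simp del: split_paired_All)
    have "\<Phi> a = \<Phi> ?b"
    proof (rule fun_eq_homogeneous)
      fix k z assume z: "z \<in> GA k"
      have "\<Phi> 1 (\<beta> r * u * \<alpha> a) = psign (\<pi> * snd l) (r * \<Phi> 1 (u * \<alpha> a))" if "r \<in> GB l" for l r u
        using Hom_lin[OF tr(1) that] by (simp add: mult.assoc)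
      then have "\<Phi> 1 (z * \<alpha> a) =
          (\<Sum>i<n. psign ((\<pi> + \<pi>) * (snd k + snd (d i))) (\<Phi> 1 (z * y i) * \<Phi> 1 (x i * \<alpha> a)))"
        by (intro expand_by_trace[OF tr(1) xy(2) expand, where g = "\<lambda>z. \<Phi> 1 (z * \<alpha> a)"] z)
          (simp_all add: distrib_right Hom_add[OF tr(1)])
      also have "\<dots> = (\<Sum>i<n. \<Phi> 1 (z * y i * \<alpha> (\<Phi> 1 (x i * \<alpha> a))))"
        by (simp add: tr(2)[OF Hom_B[OF tr(1)]])
      also have "\<dots> = \<Phi> 1 (z * \<alpha> ?b)"
        by (simp add: sum_additive[of "\<Phi> 1", OF Hom_add[OF tr(1)]] \<alpha>_sum \<alpha>_mult sum_distrib_left mult.assoc)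
      finally show "\<Phi> a z = \<Phi> ?b z"
        by (simp only: tr(3)[OF hom z] tr(3)[OF b z])
    qed (use \<Phi>_Hom[OF hom] \<Phi>_Hom[OF b] Hom_add in auto)
    then show ?case using inj by (simp add: inj_eq)
  next
    case (add a b)
    have "(\<Sum>i<n. inv \<alpha> (y i) * \<Phi> 1 (x i * \<alpha> (a + b))) =
        (\<Sum>i<n. inv \<alpha> (y i) * \<Phi> 1 (x i * \<alpha> a)) + (\<Sum>i<n. inv \<alpha> (y i) * \<Phi> 1 (x i * \<alpha> b))"
      by (simp only: \<alpha>_add distrib_left Hom_add[OF tr(1)] sum.distrib)
    then show ?case using add by simp
  qed
qed

lemma frobenius_imp_trace:
  assumes "frobenius_extension GA B \<alpha> \<beta> lam \<pi>"
  shows "\<exists>tr (n :: nat) x y d. bimod_hom GB GB M N tr \<and>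
    (\<forall>i<n. x i \<in> GA (d i) \<and> y i \<in> GA (D - d i)) \<and>
    (\<forall>e. \<forall>a\<in>GA e.
       a = psign (\<pi> * snd e) (\<Sum>i<n. psign (\<pi> * snd (d i)) (\<beta> (tr (a * y i)) * x i))) \<and>
    (\<forall>a. a = (\<Sum>i<n. inv \<alpha> (y i) * tr (x i * \<alpha> a)))"
proof -
  have "finitely_generated GB (regular GA)" "projective GB (regular GA)"
    "bimod_isomorphic GA GB (regular GA) H"
    using assms unfolding frobenius_extension_def Let_def by blast+
  then obtain n x d c \<Phi> where db: "dual_basis GB (regular GA) n x d c"
    and \<Phi>: "bimod_hom GA GB (regular GA) H \<Phi>" and bij: "bij_betw \<Phi> UNIV (carr Hom)"
    using dual_basis_exists[OF superring_GB regular_module] by (auto simp: bimod_isomorphic_def)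
  note tr = trace_of_frobenius[OF \<Phi>]
  have x: "x i \<in> GA (d i)" and c_add: "c i (u + v) = c i u + c i v"
    and c_GB: "u \<in> GA e \<Longrightarrow> c i u \<in> GB (e - d i)" and c_lin: "r \<in> B \<Longrightarrow> c i (r * u) = r * c i u"
    if "i < n" for i u v e r
    using db that by (simp_all add: dual_basis_def del: split_paired_All)
  have c_sum: "u = (\<Sum>i<n. c i u * x i)" for u
    using db by (simp add: dual_basis_def)
  have c_B: "c i u \<in> B" if "i < n" for i u
  proof (induction u rule: GA_induct)
    case (hom e u)
    then show ?case using c_GB[OF that hom] by (simp add: GB_iff)
  next
    case (add u v)
    then show ?case using c_add[OF that] by (simp add: B_add)
  qed
  have c_zero: "c i 0 = 0" if "i < n" for i using c_add[OF that, of 0 0] by simp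
  have \<beta>'0: "\<beta>' 0 = 0" using \<beta>'_add[of 0 0] B_zero by simp
  \<comment> \<open>The first sign term makes \<open>f i\<close> linear up to the parity of
    \<open>d i\<close>, as membership in degree \<open>D - d i\<close> demands after \<pi> cancels.
    The constant term is chosen to match the sign on the \<open>i\<close>-th summand of the trace
    formula.\<close>
  define f where "f = (\<lambda>i u. \<Sum>p\<in>{0, 1}. psign (p * snd (d i) + \<pi> * snd (d i)) (\<beta>' (c i (par GA p u))))"
  have f_hom: "f i u = psign (snd e * snd (d i) + \<pi> * snd (d i)) (\<beta>' (c i u))"
    if "i < n" "u \<in> GA e" for i u e
    unfolding f_def by (rule sum_par_hom[OF graded_GA that(2)]) (simp add: c_zero that \<beta>'0)
  have f_add: "f i (u + v) = f i u + f i v" if "i < n" for i u v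
    by (simp only: f_def par_add[OF graded_GA] carr_UNIV UNIV_I c_add[OF that] \<beta>'_add c_B[OF that]
        psign_add sum.distrib)
  have f_Hom: "f i \<in> Hom (D - d i)" if i: "i < n" for i
    unfolding Hom_iff
  proof (intro conjI allI ballI)
    show "f i (u + v) = f i u + f i v" for u v by (rule f_add[OF i])
    show "f i u \<in> GB (e + (D - d i) - D)" if "u \<in> GA e" for e u
      unfolding f_hom[OF i that]
      using c_GB[OF i that] by (simp add: \<beta>'_GB psign_in[OF graded_GB] algebra_simps del: add_Pair diff_Pair)
    show "f i (\<beta> r * u) = psign ((snd (D - d i) + \<pi>) * snd e) (r * f i u)" if r: "r \<in> GB e" for e r u
    proof (induction u rule: GA_induct)
      case (hom k u)
      have rB: "r \<in> B" and \<beta>r: "\<beta> r \<in> GA e" "\<beta> r \<in> B"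
        using r \<beta>_GB[OF r] by (simp_all add: GB_iff)
      have "\<beta>' (c i (\<beta> r * u)) = r * \<beta>' (c i u)"
        by (simp add: c_lin[OF i \<beta>r(2)] \<beta>'_mult \<beta>r(2) c_B[OF i] \<beta>'_\<beta> rB)
      then show ?case
        by (simp add: f_hom[OF i hom] f_hom[OF i GA_mult[OF \<beta>r(1) hom]] psign_mult_right psign_psign)
          (simp add: algebra_simps)
    next
      case (add u v)
      then show ?case by (simp only: distrib_left f_add[OF i] psign_add)
    qed
  qed
  have left: "left_hom GA (regular GA) H \<Phi>" using \<Phi> by (simp add: bimod_hom_def)
  have "\<exists>z\<in>GA (D - d i). \<Phi> z = f i" if "i < n" for i
    using homogeneous_preimage[OF _ _ left, of "f i" "D - d i"] bij graded_GA graded_Hom f_Hom[OF that]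
    by (simp add: bij_betw_def)
  then obtain z where z: "\<And>i. i < n \<Longrightarrow> z i \<in> GA (D - d i)" "\<And>i. i < n \<Longrightarrow> \<Phi> (z i) = f i"
    by metis
  \<comment> \<open>Evaluating \<Phi> at \<open>z i\<close> multiplies the argument by
    \<open>\<alpha> (z i)\<close>, so this is the element that appears next to \<open>a\<close> in
    the trace.\<close>
  define y where "y = (\<lambda>i. \<alpha> (z i))"
  have y: "y i \<in> GA (D - d i)" if "i < n" for i
    unfolding y_def by (rule \<alpha>_GA[OF z(1)[OF that]])
  have expand: "a = psign (\<pi> * snd e) (\<Sum>i<n. psign (\<pi> * snd (d i)) (\<beta> (\<Phi> 1 (a * y i)) * x i))"
    if a: "a \<in> GA e" for e a
  proof -
    have "psign (\<pi> * snd (d i)) (\<beta> (\<Phi> 1 (a * y i)) * x i) = psign (\<pi> * snd e) (c i a * x i)"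
      if i: "i < n" for i
    proof -
      have "psign (snd (D - d i) * snd e) (\<Phi> 1 (a * y i)) =
          psign (snd e * snd (d i) + \<pi> * snd (d i)) (\<beta>' (c i a))"
        using tr(3)[OF z(1)[OF i] a] by (simp add: z(2)[OF i] f_hom[OF i a] y_def)
      also have "\<dots> = psign (snd (D - d i) * snd e) (psign (\<pi> * snd e + \<pi> * snd (d i)) (\<beta>' (c i a)))"
        by (simp add: psign_psign) (simp add: algebra_simps)
      finally have "\<Phi> 1 (a * y i) = psign (\<pi> * snd e + \<pi> * snd (d i)) (\<beta>' (c i a))"
        by (simp only: psign_eq_iff)
      then show ?thesis
        by (simp add: \<beta>_psign \<beta>'_B \<beta>_\<beta>' c_B[OF i] psign_mult_left psign_psign)
    qed
    then have "(\<Sum>i<n. psign (\<pi> * snd (d i)) (\<beta> (\<Phi> 1 (a * y i)) * x i)) = psign (\<pi> * snd e) a"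
      by (subst c_sum[of a]) (simp add: psign_sum)
    then show ?thesis by (simp add: psign_psign)
  qed
  have "a = (\<Sum>i<n. inv \<alpha> (y i) * \<Phi> 1 (x i * \<alpha> a))" for a
    using trace_expansion_right[OF \<Phi> bij_betw_imp_inj_on[OF bij] x y expand] .
  moreover have "bimod_hom GB GB M N (\<Phi> 1)" using tr(1,2) by (simp add: trace_iff)
  ultimately show ?thesis using x y expand by blast
qed

text \<open>The two formulas have separate roles: the first gives the dual basis and the
  surjectivity of the action on the trace, the second its injectivity, since a vanishing image makes
  every \<open>tr (x i * \<alpha> a)\<close> zero.\<close>

lemma trace_imp_frobenius:
  assumes hom: "bimod_hom GB GB M N tr"
    and xy: "\<And>i. i < n \<Longrightarrow> x i \<in> GA (d i)" "\<And>i. i < n \<Longrightarrow> y i \<in> GA (D - d i)"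
    and expand: "\<And>e a. a \<in> GA e \<Longrightarrow>
      a = psign (\<pi> * snd e) (\<Sum>i<n. psign (\<pi> * snd (d i)) (\<beta> (tr (a * y i)) * x i))"
    and expand': "\<And>a. a = (\<Sum>i<(n::nat). inv \<alpha> (y i) * tr (x i * \<alpha> a))"
  shows "frobenius_extension GA B \<alpha> \<beta> lam \<pi>"
proof -
  have tr: "tr \<in> Hom 0" and tr_right: "\<And>u b. b \<in> B \<Longrightarrow> tr (u * \<alpha> b) = tr u * b"
    using hom by (simp_all add: trace_iff)
  have trc: "tr \<in> carr Hom" using tr by (rule in_carr)
  note tr_add = Hom_add[OF tr] and tr_B = Hom_B[OF tr]
  have tr0: "tr 0 = 0" using tr_add[of 0 0] by simp
  \<comment> \<open>The sign depending on the parity of \<open>a\<close> compensates the signed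
    linearity of the trace, and \<beta> undoes its twist; together they make \<open>c i\<close>
    strictly linear over \<open>B\<close>.\<close>
  define c where "c = (\<lambda>i a. \<Sum>p\<in>{0, 1}. psign (\<pi> * p + \<pi> * snd (d i)) (\<beta> (tr (par GA p a * y i))))"
  have c_hom: "c i a = psign (\<pi> * snd e + \<pi> * snd (d i)) (\<beta> (tr (a * y i)))" if "a \<in> GA e" for i a e
    unfolding c_def by (rule sum_par_hom[OF graded_GA that]) (simp add: tr0 \<beta>_zero)
  have c_add: "c i (a + b) = c i a + c i b" for i a b
    by (simp only: c_def par_add[OF graded_GA] carr_UNIV UNIV_I distrib_right tr_add \<beta>_add tr_B
        psign_add sum.distrib)
  have "dual_basis GB (regular GA) n x d c"
    unfolding dual_basis_def
  proof (intro conjI allI impI ballI)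
    fix i assume i: "i < n"
    show "x i \<in> gr (regular GA) (d i)" using xy(1)[OF i] by simp
    show "c i (a + b) = c i a + c i b" for a b by (rule c_add)
    show "c i a \<in> GB (e - d i)" if "a \<in> gr (regular GA) e" for e a
    proof -
      have a: "a \<in> GA e" using that by simp
      have "tr (a * y i) \<in> GB (e + (D - d i) + 0 - D)" by (rule Hom_GB[OF tr GA_mult[OF a xy(2)[OF i]]])
      then have "tr (a * y i) \<in> GB (e - d i)" by (simp add: algebra_simps del: add_Pair diff_Pair)
      then show ?thesis unfolding c_hom[OF a] by (intro psign_in[OF graded_GB] \<beta>_GB)
    qed
    show "c i (lact (regular GA) r a) = r * c i a" if "r \<in> carr GB" for r a
    proof -
      have "r \<in> B" using that by simp
      then have "c i (r * a) = r * c i a"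
      proof (induction r rule: B_induct)
        case (hom k r)
        note r = hom
        then have rA: "r \<in> GA k" and rB: "r \<in> B" by (simp_all add: GB_iff)
        show ?case
        proof (induction a rule: GA_induct)
          case (hom e a)
          \<comment> \<open>The scalar is written as the image under \<beta> of its preimage so that
            the twisted linearity of the trace applies.\<close>
          have "tr (r * a * y i) = psign (\<pi> * snd k) (\<beta>' r * tr (a * y i))"
            using Hom_lin[OF tr \<beta>'_GB[OF r], of "a * y i"] by (simp add: \<beta>_\<beta>' rB mult.assoc)
          then have "\<beta> (tr (r * a * y i)) = psign (\<pi> * snd k) (r * \<beta> (tr (a * y i)))"
            by (simp add: \<beta>_psign \<beta>_mult B_mult \<beta>'_B \<beta>_\<beta>' rB tr_B)
          then show ?case
            by (simp add: c_hom[OF hom] c_hom[OF GA_mult[OF rA hom]] psign_mult_right psign_psign)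
              (simp add: algebra_simps)
        next
          case (add a b)
          then show ?case by (simp only: distrib_left c_add)
        qed
      next
        case (add r s)
        then show ?case by (simp only: distrib_right c_add)
      qed
      then show ?thesis by simp
    qed
  next
    fix a :: 'a
    have "a = (\<Sum>i<n. c i a * x i)"
    proof (induction a rule: GA_induct)
      case (hom e a)
      then show ?case
        using expand[OF hom] by (simp add: c_hom[OF hom] psign_mult_left psign_sum psign_psign)
    next
      case (add a b)
      have "(\<Sum>i<n. c i (a + b) * x i) = (\<Sum>i<n. c i a * x i) + (\<Sum>i<n. c i b * x i)"
        by (simp only: c_add distrib_right sum.distrib)
      then show ?case using add by simp
    qed
    then show "a = (\<Sum>i<n. lact (regular GA) (c i a) (x i))" by simp
  qed
  then have fg: "finitely_generated GB (regular GA)" and proj: "projective GB (regular GA)"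
    using dual_basis_finitely_generated dual_basis_projective superring_GB regular_module by blast+
  define \<Phi> where "\<Phi> = (\<lambda>a. lact H a tr)"
  have \<Phi>: "\<Phi> a u = psign (snd e * snd k) (tr (u * \<alpha> a))" if "a \<in> GA e" "u \<in> GA k" for a e u k
    using lact_H[OF that(1) tr that(2)] by (simp add: \<Phi>_def)
  have \<Phi>_Hom: "\<Phi> a \<in> Hom e" if "a \<in> GA e" for a e
    using lact_H_Hom[OF that tr] by (simp add: \<Phi>_def)
  have \<Phi>_add: "\<Phi> (a + b) = \<Phi> a + \<Phi> b" for a b
    unfolding \<Phi>_def by (rule lact_H_add_left[OF trc])
  have \<Phi>_carr: "\<Phi> a \<in> carr Hom" for a
  proof (induction a rule: GA_induct)
    case (hom d a)
    show ?case using \<Phi>_Hom[OF hom] by (rule in_carr)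
  next
    case (add a b)
    then show ?case by (simp only: \<Phi>_add carr_add[OF graded_Hom])
  qed
  have left: "left_hom GA (regular GA) H \<Phi>"
    unfolding left_hom_def
  proof (intro conjI allI ballI)
    show "\<Phi> (a + b) = \<Phi> a + \<Phi> b" for a b by (rule \<Phi>_add)
    show "\<Phi> ` gr (regular GA) e \<subseteq> gr H e" for e by (rule image_subsetI) (simp add: \<Phi>_Hom)
    show "\<Phi> (lact (regular GA) r a) = lact H r (\<Phi> a)" for r a
      by (simp only: lact_regular \<Phi>_def lact_H_mult[OF trc])
  qed
  have right: "\<Phi> (a * b) = ract H (\<Phi> a) b" if "b \<in> B" for a b
    using that
  proof (induction b rule: B_induct)
    case (hom k b)
    note b = hom
    then have bA: "b \<in> GA k" and bB: "b \<in> B" by (simp_all add: GB_iff)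
    show ?case
    proof (induction a rule: GA_induct)
      case (hom e a)
      show ?case
      proof (rule fun_eq_homogeneous)
        fix l u assume u: "u \<in> GA l"
        have "ract H (\<Phi> a) b u = psign (snd k * snd l) (\<Phi> a u * b)"
          by (rule ract_H[OF carr_Hom_add[OF \<Phi>_carr] b u])
        then show "\<Phi> (a * b) u = ract H (\<Phi> a) b u"
          by (simp add: \<Phi>[OF hom u] \<Phi>[OF GA_mult[OF hom bA] u] \<alpha>_mult tr_right[OF bB] psign_mult_left
              psign_psign flip: mult.assoc) (simp add: algebra_simps)
      qed (simp_all only: carr_Hom_add[OF \<Phi>_carr] ract_H_add_arg[OF \<Phi>_carr])
    next
      case (add a a')
      then show ?case by (simp only: distrib_right \<Phi>_add ract_H_add_left)
    qed
  next
    case (add b c)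
    then show ?case by (simp only: distrib_left \<Phi>_add ract_H_add_right)
  qed
  have inj: "inj_on \<Phi> (carr (gr (regular GA)))"
  proof (rule left_hom_inj_on[OF left])
    fix e a assume "a \<in> gr (regular GA) e" and 0: "\<Phi> a = 0"
    then have a: "a \<in> GA e" by simp
    have "tr (x i * \<alpha> a) = 0" if i: "i < n" for i
    proof -
      have "psign (snd e * snd (d i)) (tr (x i * \<alpha> a)) = psign (snd e * snd (d i)) 0"
        using \<Phi>[OF a xy(1)[OF i]] 0 by simp
      then show ?thesis by (simp only: psign_eq_iff)
    qed
    then show "a = 0" using expand'[of a] by simp
  qed (simp_all add: graded_GA graded_Hom)
  have surj: "\<Phi> ` carr (gr (regular GA)) = carr (gr H)"
  proof (rule left_hom_image[OF left])
    fix e f assume "f \<in> gr H e"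
    then have f: "f \<in> Hom e" by simp
    \<comment> \<open>In the expansion of \<open>f u\<close> the exponent is the parity of
      \<open>f\<close> times the sum of those of \<open>u\<close> and \<open>x i\<close>. The first
      product is the sign in \<open>\<Phi> ?a u\<close>; the second must be built into the
      preimage.\<close>
    let ?a = "\<Sum>i<n. psign (snd (d i) * snd e) (inv \<alpha> (y i) * f (x i))"
    have "inv \<alpha> (y i) * f (x i) \<in> GA e" if i: "i < n" for i
    proof -
      have "f (x i) \<in> GA (d i + e - D)" using Hom_GB[OF f xy(1)[OF i]] by (simp only: GB_iff)
      from GA_mult[OF inv_\<alpha>_GA[OF xy(2)[OF i]] this]
      have "inv \<alpha> (y i) * f (x i) \<in> GA (D - d i + (d i + e - D))" .
      then show ?thesis by (simp add: algebra_simps del: add_Pair diff_Pair)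
    qed
    then have a: "?a \<in> GA e" by (intro graded_group_sum[OF graded_GA] psign_in[OF graded_GA]) simp
    have "\<Phi> ?a = f"
    proof (rule fun_eq_homogeneous)
      fix k u assume u: "u \<in> GA k"
      have "f u = (\<Sum>i<n. psign ((snd e + \<pi> + \<pi>) * (snd k + snd (d i))) (tr (u * y i) * f (x i)))"
        by (intro expand_by_trace[OF tr xy(2) expand] Hom_add[OF f] Hom_lin[OF f] u)
      also have "\<dots> = psign (snd e * snd k) (\<Sum>i<n. psign (snd (d i) * snd e) (tr (u * y i) * f (x i)))"
        by (simp add: psign_sum psign_psign) (simp add: algebra_simps)
      also have "(\<Sum>i<n. psign (snd (d i) * snd e) (tr (u * y i) * f (x i))) = tr (u * \<alpha> ?a)"
        by (simp add: sum_additive[of tr, OF tr_add] \<alpha>_sum \<alpha>_psign \<alpha>_mult sum_distrib_left psign_mult_right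
            psign_additive[of tr, OF tr_add] tr_right[OF Hom_B[OF f]] flip: mult.assoc)
      also have "psign (snd e * snd k) (tr (u * \<alpha> ?a)) = \<Phi> ?a u" by (rule \<Phi>[OF a u, symmetric])
      finally show "\<Phi> ?a u = f u" by (rule sym)
    qed (simp_all only: carr_Hom_add[OF \<Phi>_carr] Hom_add[OF f])
    then show "\<exists>a\<in>carr (gr (regular GA)). \<Phi> a = f" by auto
  qed (simp_all add: graded_GA graded_Hom)
  have "bimod_hom GA GB (regular GA) H \<Phi>"
    using left right by (simp add: bimod_hom_def)
  then have "bimod_isomorphic GA GB (regular GA) H"
    using inj surj unfolding bimod_isomorphic_def bij_betw_def by blast
  then show ?thesis using fg proj unfolding frobenius_extension_def Let_def by blast
qed

end

theorem proposition4p9: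
  fixes GA :: "'l::ab_group_add \<times> bit \<Rightarrow> 'a::{ring, monoid_mult} set"
    and B :: "'a set" and \<alpha> \<beta> :: "'a \<Rightarrow> 'a" and lam :: 'l and \<pi> :: bit
  assumes "graded_superring GA" and "carr GA = UNIV"
    and "graded_subring GA B"
    and "graded_automorphism GA \<alpha>"
    and "graded_automorphism (restrict_grading GA B) \<beta>"
  shows "frobenius_extension GA B \<alpha> \<beta> lam \<pi> \<longleftrightarrow>
    (\<exists>(tr :: 'a \<Rightarrow> 'a) (n :: nat) (x :: nat \<Rightarrow> 'a) (y :: nat \<Rightarrow> 'a) (d :: nat \<Rightarrow> 'l \<times> bit).
       bimod_hom (restrict_grading GA B) (restrict_grading GA B)
         (twisted GA \<beta> \<alpha>)
         (shift (restrict_grading GA B) lam \<pi> (regular (restrict_grading GA B))) tr \<and>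
       (\<forall>i<n. x i \<in> GA (d i) \<and> y i \<in> GA (lam - fst (d i), \<pi> + snd (d i))) \<and>
       (\<forall>e. \<forall>a\<in>GA e.
          a = psign (\<pi> * snd e) (\<Sum>i<n. psign (\<pi> * snd (d i)) (\<beta> (tr (a * y i)) * x i))) \<and>
       (\<forall>a. a = (\<Sum>i<n. inv \<alpha> (y i) * tr (x i * \<alpha> a))))"
proof -
  interpret twisted_extension GA B \<alpha> \<beta> lam \<pi> by unfold_locales (fact assms)+
  \<comment> \<open>Sum and difference of parities coincide, so the degrees of the
    \<open>y i\<close> are those used in the locale.\<close>
  have deg: "(lam - fst e, \<pi> + snd e) = (lam, \<pi>) - e" for e :: "'l \<times> bit"
    by (simp add: prod_eq_iff)
  show ?thesis
    unfolding deg using frobenius_imp_trace trace_imp_frobenius by blast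
qed

end
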